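(* Let $G$ be an infinite finitely generated group and let $H$ be a finitely generated group with more than one element. Then the wreath product $H\wr G$ (with respect to any finite symmetric generating set) does not satisfy $\{f(n)\}$-retainment for any subexponential function $f:\{1,2,\dots\}\to\{0,1,2,\dots\}$, i.e. any $f$ with $\lim_{n}\frac1n\log f(n)=0$.
   Context: The (restricted) wreath product $H\wr G$ is the semidirect product $G\ltimes\bigoplus_G H$: its elements are pairs $(g,L)$ with $g\in G$ and $L:G\to H$ a function equal to the identity $e_H$ at all but finitely many points, with product $(g_1,L_1)(g_2,L_2)=(g_1g_2,L_1L_2^{g_1})$, where $(L_1L_2^{g_1})(s)=L_1(s)L_2(g_1^{-1}s)$. For a finitely generated group $\Gamma$ with finite symmetric generating set $S$, consider its Cayley graph, with vertex set $\Gamma$ and edges $x\sim xs$, $s\in S$. Let $B_n$ be the ball of radius $n$ around the identity for the graph distance and $v_\Gamma(n)=|B_n|$. For functions write $a\preceq b$ if there is a constant $C>0$ with $a(n)\le C\,b(Cn)+C$ for all $n$; $a$ and $b$ are equivalent if $a\preceq b$ and $b\preceq a$. Fire process: a fire breaks out at time $0$ on a finite set $F_0\subset\Gamma$. At each time $n\ge 1$ a set $W_n$ of at most $f(n)$ vertices not on fire ($W_n\cap F_{n-1}=\emptyset$) is declared protected forever, and then $F_n=F_{n-1}\cup\{x : x\sim y \text{ for some } y\in F_{n-1},\ x\notin W_1\cup\dots\cup W_n\}$. Such a sequence $\{W_n\}$ is an $\{f(n)\}$-allowed strategy. Let $U=\Gamma\setminus\bigcup_n F_n$. $\Gamma$ satisfies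 $\{f(n)\}$-retainment if for every finite $F_0$ there is an $\{f(n)\}$-allowed strategy such that $n\mapsto|U\cap B_n|$ is equivalent to $v_\Gamma$. *)

theory Defs
  imports Complex_Main "HOL-Library.Extended_Nat" "HOL-Algebra.Generated_Groups"
begin

definition finitely_generated_group :: "('a, 'c) monoid_scheme \<Rightarrow> bool" where
  "finitely_generated_group G \<longleftrightarrow>
     group G \<and> (\<exists>S. finite S \<and> S \<subseteq> carrier G \<and> generate G S = carrier G)"

definition symmetric_generating_set :: "('a, 'c) monoid_scheme \<Rightarrow> 'a set \<Rightarrow> bool" where
  "symmetric_generating_set \<Gamma> S \<longleftrightarrow>
     S \<subseteq> carrier \<Gamma> \<and> (\<forall>s\<in>S. inv\<^bsub>\<Gamma>\<^esub> s \<in> S) \<and> generate \<Gamma> S = carrier \<Gamma>"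

(* The lamp configurations L live on carrier G only: outside it they are pinned to "undefined",
   so that equality of pairs is equality of the restrictions to carrier G. *)
definition wreath_product ::
    "('b, 'd) monoid_scheme \<Rightarrow> ('a, 'c) monoid_scheme \<Rightarrow> ('a \<times> ('a \<Rightarrow> 'b)) monoid" where
  "wreath_product H G =
     \<lparr>carrier = carrier G \<times>
        {L \<in> carrier G \<rightarrow>\<^sub>E carrier H. finite {s \<in> carrier G. L s \<noteq> \<one>\<^bsub>H\<^esub>}},
      mult = (\<lambda>(g1, L1) (g2, L2).
        (g1 \<otimes>\<^bsub>G\<^esub> g2, \<lambda>s\<in>carrier G. L1 s \<otimes>\<^bsub>H\<^esub> L2 (inv\<^bsub>G\<^esub> g1 \<otimes>\<^bsub>G\<^esub> s))),
      one = (\<one>\<^bsub>G\<^esub>, \<lambda>s\<in>carrier G. \<one>\<^bsub>H\<^esub>)\<rparr>"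

definition cayley_edges :: "('a, 'c) monoid_scheme \<Rightarrow> 'a set \<Rightarrow> ('a \<times> 'a) set" where
  "cayley_edges \<Gamma> S = {(x, x \<otimes>\<^bsub>\<Gamma>\<^esub> s) | x s. x \<in> carrier \<Gamma> \<and> s \<in> S}"

definition cayley_dist :: "('a, 'c) monoid_scheme \<Rightarrow> 'a set \<Rightarrow> 'a \<Rightarrow> 'a \<Rightarrow> enat" where
  "cayley_dist \<Gamma> S x y = Inf {enat k | k. (x, y) \<in> cayley_edges \<Gamma> S ^^ k}"

definition cayley_ball :: "('a, 'c) monoid_scheme \<Rightarrow> 'a set \<Rightarrow> nat \<Rightarrow> 'a set" where
  "cayley_ball \<Gamma> S n = {x \<in> carrier \<Gamma>. cayley_dist \<Gamma> S \<one>\<^bsub>\<Gamma>\<^esub> x \<le> enat n}"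

(* C is real, so b (C n) is read at the integer part of C n; for counts in balls this is exactly
   the ball of real radius C n. *)
definition growth_le :: "(nat \<Rightarrow> nat) \<Rightarrow> (nat \<Rightarrow> nat) \<Rightarrow> bool" where
  "growth_le a b \<longleftrightarrow>
     (\<exists>C::real. C > 0 \<and> (\<forall>n. real (a n) \<le> C * real (b (nat \<lfloor>C * real n\<rfloor>)) + C))"

definition growth_equiv :: "(nat \<Rightarrow> nat) \<Rightarrow> (nat \<Rightarrow> nat) \<Rightarrow> bool" where
  "growth_equiv a b \<longleftrightarrow> growth_le a b \<and> growth_le b a"

(* The value W 0 is never used: protected sets are indexed by times n >= 1. *)
primrec fire ::
    "('a, 'c) monoid_scheme \<Rightarrow> 'a set \<Rightarrow> 'a set \<Rightarrow> (nat \<Rightarrow> 'a set) \<Rightarrow> nat \<Rightarrow> 'a set" where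
  "fire \<Gamma> S F0 W 0 = F0"
| "fire \<Gamma> S F0 W (Suc n) =
     fire \<Gamma> S F0 W n \<union>
     {x. (\<exists>y \<in> fire \<Gamma> S F0 W n. (y, x) \<in> cayley_edges \<Gamma> S) \<and> x \<notin> (\<Union>i\<in>{1..Suc n}. W i)}"

definition allowed_strategy ::
    "('a, 'c) monoid_scheme \<Rightarrow> 'a set \<Rightarrow> (nat \<Rightarrow> nat) \<Rightarrow> 'a set \<Rightarrow> (nat \<Rightarrow> 'a set) \<Rightarrow> bool" where
  "allowed_strategy \<Gamma> S f F0 W \<longleftrightarrow>
     (\<forall>n\<ge>1. W n \<subseteq> carrier \<Gamma> \<and> finite (W n) \<and> card (W n) \<le> f n \<and>
            W n \<inter> fire \<Gamma> S F0 W (n - 1) = {})"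

definition unburnt ::
    "('a, 'c) monoid_scheme \<Rightarrow> 'a set \<Rightarrow> 'a set \<Rightarrow> (nat \<Rightarrow> 'a set) \<Rightarrow> 'a set" where
  "unburnt \<Gamma> S F0 W = carrier \<Gamma> - (\<Union>n. fire \<Gamma> S F0 W n)"

definition retainment :: "('a, 'c) monoid_scheme \<Rightarrow> 'a set \<Rightarrow> (nat \<Rightarrow> nat) \<Rightarrow> bool" where
  "retainment \<Gamma> S f \<longleftrightarrow>
     (\<forall>F0. finite F0 \<and> F0 \<subseteq> carrier \<Gamma> \<longrightarrow>
        (\<exists>W. allowed_strategy \<Gamma> S f F0 W \<and>
             growth_equiv (\<lambda>n. card (unburnt \<Gamma> S F0 W \<inter> cayley_ball \<Gamma> S n))
                          (\<lambda>n. card (cayley_ball \<Gamma> S n))))"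

(* The value f 0 is irrelevant. Since ln 0 = 0 here, f may vanish, even infinitely often; where f is
   eventually positive this is literally the usual condition. *)
definition subexponential :: "(nat \<Rightarrow> nat) \<Rightarrow> bool" where
  "subexponential f \<longleftrightarrow> (\<lambda>n. ln (real (f n)) / real n) \<longlonglongrightarrow> 0"

end

theory Submission
  imports Defs
begin

text \<open>
  A lamplighter path can spread out exponentially fast at both of its ends. Let \<open>\<sigma> 0, \<dots>, \<sigma> m\<close> be
  a simple walk in \<open>G\<close> that starts at the identity, and let \<open>h\<close> be a nontrivial element of \<open>H\<close>. For
  a random set \<open>b\<close> of sites on this walk, the trail of \<open>b\<close> follows \<open>\<sigma>\<close> and writes \<open>h\<close> at the sites
  of \<open>b\<close>; its position after \<open>i\<close> steps takes every value with probability at most \<open>2\<^sup>-\<^sup>i\<close>. Given a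
  target \<open>x\<close> in the ball of radius \<open>m\<close> and an independent random set \<open>c\<close>, the fire is sent along the
  trail of \<open>b\<close>, then to the end of the translate by \<open>x\<close> of the trail of \<open>c\<close>, and then backwards
  along this translate to \<open>x\<close>. The middle part can be arranged (\<open>middle_paths\<close>) to have length
  \<open>O(m)\<close> and such that at each of its vertices one of \<open>b\<close>, \<open>c\<close> determines the other up to boundedly
  many choices once one knows how far the path has come. Hence each vertex lies on the middle part
  with probability at most \<open>O(m) 2\<^sup>-\<^sup>m\<close>.

  Up to time \<open>k\<close> at most \<open>p(k)\<close> vertices are protected, where \<open>p\<close> is subexponential. A fire that starts
  on a ball of radius \<open>R\<close> may use the \<open>(R + k)\<close>-th vertex of the trail at time \<open>k\<close>, so the expected
  number of protected vertices on the first part is at most \<open>\<Sum>\<^sub>k p(k) 2\<^sup>-\<^sup>R\<^sup>-\<^sup>k\<close>, which is small if \<open>R\<close>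
  is large. The middle part meets protected vertices with probability \<open>p(O(m)) O(m) 2\<^sup>-\<^sup>m\<close>. On the
  last part, choose \<open>2\<^bsup>j\<^sub>0\<^esup>\<close> as a large multiple of \<open>p(O(m))\<close>: then the vertices at least \<open>j\<^sub>0\<close> moves
  before \<open>x\<close> are protected with small total probability, and the others are unprotected if \<open>x\<close> has
  distance more than \<open>j\<^sub>0\<close> from all protected vertices. Thus every
  such \<open>x\<close> burns (\<open>far_points_burn\<close>), and the unburnt part of the ball of radius \<open>m\<close> lies in
  the \<open>j\<^sub>0\<close>-neighbourhood of \<open>p(O(m))\<close> vertices, whose size is subexponential in \<open>m\<close>
  (\<open>unburnt_subexponential\<close>). The trails show that the wreath product itself grows
  exponentially, so this is too small.

  An arbitrary generating set enters in two ways. Finitely many elementary moves lie in a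
  ball of some radius \<open>l\<close>, so one move counts as \<open>l\<close> time steps, and protected sets are replaced by their
  \<open>l\<close>-neighbourhoods (\<open>fire_reach\<close>). In the other direction, an element of word length \<open>n\<close> can be built
  by a walk in \<open>G\<close> of length \<open>O(n)\<close> that writes lamp values of total length \<open>O(n)\<close>
  (\<open>tour_cost_word_ball\<close>).
\<close>

section \<open>Subexponential functions\<close>

text \<open>
  This form of subexponential growth passes directly to sums, products and dilations of the
  argument.
\<close>

definition subexp :: "(nat \<Rightarrow> nat) \<Rightarrow> bool" where
  "subexp p \<longleftrightarrow> (\<forall>a>1. \<exists>K. \<forall>n. real (p n) \<le> K * a ^ n)"

lemma subexpD:
  assumes "subexp p" "a > 1"
  shows "\<exists>K>0. \<forall>n. real (p n) \<le> K * a ^ n"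
proof -
  obtain K where K: "\<forall>n. real (p n) \<le> K * a ^ n"
    using assms unfolding subexp_def by blast
  have "real (p n) \<le> max K 1 * a ^ n" for n
    using K[rule_format, of n] assms(2)
    by (smt (verit) mult_right_mono zero_le_power)
  thus ?thesis by (intro exI[of _ "max K 1"]) simp
qed

lemma subexp_const: "subexp (\<lambda>_. c)"
  unfolding subexp_def
proof (intro allI impI)
  fix a :: real assume "a > 1"
  hence "1 \<le> a ^ n" for n by simp
  hence "real c \<le> real c * a ^ n" for n by (simp add: mult_le_cancel_left1)
  thus "\<exists>K. \<forall>n. real c \<le> K * a ^ n" by blast
qed

lemma subexp_linear: "subexp (\<lambda>n. n)"
  unfolding subexp_def
proof (intro allI impI)
  fix a :: real assume a: "a > 1"
  have "real n \<le> 1 / (a - 1) * a ^ n" for n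
  proof -
    have "real n * (a - 1) \<le> a ^ n"
      using Bernoulli_inequality[of "a - 1" n] a by simp
    thus ?thesis using a by (simp add: field_simps)
  qed
  thus "\<exists>K. \<forall>n. real n \<le> K * a ^ n" by blast
qed

lemma subexp_add:
  assumes "subexp p" "subexp q" shows "subexp (\<lambda>n. p n + q n)"
  unfolding subexp_def
proof (intro allI impI)
  fix a :: real assume a: "a > 1"
  obtain K L where "\<And>n. real (p n) \<le> K * a ^ n" "\<And>n. real (q n) \<le> L * a ^ n"
    using subexpD[OF assms(1) a] subexpD[OF assms(2) a] by metis
  hence "real (p n + q n) \<le> (K + L) * a ^ n" for n
    by (simp add: distrib_right add_mono)
  thus "\<exists>K. \<forall>n. real (p n + q n) \<le> K * a ^ n" by blast
qed

lemma subexp_mult: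
  assumes "subexp p" "subexp q" shows "subexp (\<lambda>n. p n * q n)"
  unfolding subexp_def
proof (intro allI impI)
  fix a :: real assume a: "a > 1"
  hence s: "sqrt a > 1" by simp
  obtain K where K: "K > 0" "\<And>n. real (p n) \<le> K * sqrt a ^ n" using subexpD[OF assms(1) s] by blast
  obtain L where L: "L > 0" "\<And>n. real (q n) \<le> L * sqrt a ^ n" using subexpD[OF assms(2) s] by blast
  have "real (p n * q n) \<le> (K * L) * a ^ n" for n
  proof -
    have "real (p n) * real (q n) \<le> (K * sqrt a ^ n) * (L * sqrt a ^ n)"
      using K L a by (intro mult_mono) (auto intro!: mult_nonneg_nonneg zero_le_power)
    also have "\<dots> = K * L * (sqrt a * sqrt a) ^ n" by (simp only: power_mult_distrib ac_simps)
    finally show ?thesis using a by simp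
  qed
  thus "\<exists>K. \<forall>n. real (p n * q n) \<le> K * a ^ n" by blast
qed

lemma subexp_power: "subexp p \<Longrightarrow> subexp (\<lambda>n. p n ^ d)"
  by (induction d) (simp_all add: subexp_const subexp_mult)

lemma subexp_affine_index:
  assumes "subexp p" shows "subexp (\<lambda>n. p (c * n + d))"
  unfolding subexp_def
proof (intro allI impI)
  fix a :: real assume a: "a > 1"
  define r where "r = root (Suc c) a"
  have r: "r > 1" "r ^ Suc c = a" using a by (simp_all add: r_def del: power_Suc)
  obtain K where K: "K > 0" "\<And>n. real (p n) \<le> K * r ^ n" using subexpD[OF assms r(1)] by blast
  have "real (p (c * n + d)) \<le> (K * r ^ d) * a ^ n" for n
  proof -
    have "r ^ (c * n + d) \<le> r ^ (Suc c * n + d)" using r(1) by (intro power_increasing) auto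
    also have "\<dots> = r ^ d * a ^ n" unfolding power_add power_mult r(2) by simp
    finally have "K * r ^ (c * n + d) \<le> K * (r ^ d * a ^ n)" using K(1) by simp
    thus ?thesis using K(2)[of "c * n + d"] by (simp add: mult.assoc)
  qed
  thus "\<exists>K. \<forall>n. real (p (c * n + d)) \<le> K * a ^ n" by blast
qed

lemma subexp_eventually_less:
  assumes "subexp p" shows "\<exists>n0. \<forall>n\<ge>n0. p n < 2 ^ n"
proof -
  obtain K where K: "K > 0" "\<And>n. real (p n) \<le> K * (3/2) ^ n"
    using subexpD[OF assms, of "3/2"] by auto
  obtain n0 where n0: "K < (4/3) ^ n0" using real_arch_pow[of "4/3" K] by auto
  have "p n < 2 ^ n" if "n \<ge> n0" for n
  proof -
    have "(4/3::real) ^ n0 \<le> (4/3) ^ n" using that by (intro power_increasing) auto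
    with n0 have "K < (4/3) ^ n" by (rule less_le_trans)
    hence "K * (3/2) ^ n < (4/3) ^ n * (3/2) ^ n" by (intro mult_strict_right_mono) auto
    also have "\<dots> = (2::real) ^ n" by (simp flip: power_mult_distrib)
    finally have "K * (3/2) ^ n < (2::real) ^ n" .
    with K(2)[of n] have "real (p n) < 2 ^ n" by (rule le_less_trans)
    thus ?thesis by (metis of_nat_less_iff of_nat_numeral of_nat_power)
  qed
  thus ?thesis by blast
qed

lemma subexp_sum:
  assumes "subexp p" shows "subexp (\<lambda>n. \<Sum>i=1..n. p i)"
  unfolding subexp_def
proof (intro allI impI)
  fix a :: real assume a: "a > 1"
  obtain K where K: "K > 0" "\<And>n. real (p n) \<le> K * a ^ n" using subexpD[OF assms a] by blast
  have "real (\<Sum>i=1..n. p i) \<le> (K * (a / (a - 1))) * a ^ n" for n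
  proof (induction n)
    case 0 show ?case using K a by simp
  next
    case (Suc n)
    have "K * (a / (a - 1)) * a ^ n + K * a ^ Suc n = (K * (a / (a - 1))) * a ^ Suc n"
      using a by (simp add: field_simps)
    thus ?case using Suc K(2)[of "Suc n"] by simp
  qed
  thus "\<exists>K. \<forall>n. real (\<Sum>i=1..n. p i) \<le> K * a ^ n" by blast
qed

lemma subexponential_imp_subexp:
  assumes "subexponential f" shows "subexp f"
  unfolding subexp_def
proof (intro allI impI)
  fix a :: real assume a: "a > 1"
  have "eventually (\<lambda>n. ln (real (f n)) / real n < ln a) sequentially"
    using assms a unfolding subexponential_def by (intro order_tendstoD) auto
  then obtain n0 where n0: "\<And>n. n \<ge> n0 \<Longrightarrow> ln (real (f n)) / real n < ln a"
    by (auto simp: eventually_sequentially)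
  define K where "K = 1 + (\<Sum>i\<le>n0. real (f i))"
  have K1: "K \<ge> 1" unfolding K_def by (simp add: sum_nonneg)
  have "real (f n) \<le> K * a ^ n" for n
  proof (cases "n \<le> n0")
    case True
    have "real (f n) \<le> (\<Sum>i\<le>n0. real (f i))"
      using True by (intro member_le_sum) auto
    hence "real (f n) \<le> K * 1" by (simp add: K_def)
    also have "\<dots> \<le> K * a ^ n" using K1 a by (intro mult_left_mono) auto
    finally show ?thesis .
  next
    case False
    have "real (f n) \<le> a ^ n"
    proof (cases "f n = 0")
      case True thus ?thesis using a by simp
    next
      case f: False
      have "ln (real (f n)) < real n * ln a"
        using n0[of n] False by (simp add: field_simps)
      also have "\<dots> = ln (a ^ n)" using a by (simp add: ln_realpow)
      finally show ?thesis using f a by (simp del: ln_realpow)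
    qed
    also have "\<dots> \<le> K * a ^ n" using K1 a by (simp add: mult_le_cancel_right1)
    finally show ?thesis .
  qed
  thus "\<exists>K. \<forall>n. real (f n) \<le> K * a ^ n" by blast
qed

text \<open>
  A fire that starts with radius \<open>R\<close> follows trails which at time \<open>k\<close> are spread over \<open>2\<^sup>R\<^sup>+\<^sup>k\<close>
  vertices. The inequality bounds by \<open>1/4\<close> the expected number of the \<open>p k\<close> vertices protected by
  time \<open>k\<close> that such a trail meets at time \<open>k\<close>, summed over \<open>k\<close>. As \<open>p\<close> grows more slowly than
  \<open>(3/2)\<^sup>k\<close>, the series \<open>\<Sum> p k / 2\<^sup>k\<close> converges, and \<open>R\<close> absorbs its value.
\<close>

lemma subexp_head_start:
  assumes "subexp p"
  shows "\<exists>R. \<forall>m. 4 * (\<Sum>k=1..m. p k * 2 ^ (m - k)) \<le> 2 ^ (R + m)"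
proof -
  obtain K where K: "K > 0" "\<And>n. real (p n) \<le> K * (3/2) ^ n"
    using subexpD[OF assms, of "3/2"] by auto
  obtain R where R: "16 * K < 2 ^ R" using real_arch_pow[of 2 "16 * K"] by auto
  \<comment> \<open>The subtracted term is what makes the induction close.\<close>
  have bound: "real (\<Sum>k=1..m. p k * 2 ^ (m - k)) \<le> 3 * K * (2 ^ m - (3/2) ^ m)" for m
  proof (induction m)
    case 0 show ?case by simp
  next
    case (Suc m)
    have "(\<Sum>k=1..Suc m. p k * 2 ^ (Suc m - k)) = 2 * (\<Sum>k=1..m. p k * 2 ^ (m - k)) + p (Suc m)"
      by (simp add: sum_distrib_left Suc_diff_le algebra_simps)
    hence "real (\<Sum>k=1..Suc m. p k * 2 ^ (Suc m - k))
        \<le> 2 * (3 * K * (2 ^ m - (3/2) ^ m)) + K * (3/2) ^ Suc m"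
      using Suc K(2)[of "Suc m"] by (simp del: power_Suc)
    also have "\<dots> = 3 * K * (2 ^ Suc m - (3/2) ^ Suc m)" by (simp add: algebra_simps)
    finally show ?case .
  qed
  have "4 * (\<Sum>k=1..m. p k * 2 ^ (m - k)) \<le> 2 ^ (R + m)" for m
  proof -
    have "3 * K * (2 ^ m - (3/2) ^ m) \<le> 3 * K * 2 ^ m" using K(1) by simp
    hence "real (4 * (\<Sum>k=1..m. p k * 2 ^ (m - k))) \<le> 4 * (3 * K * 2 ^ m)"
      using bound[of m] by simp
    also have "\<dots> \<le> (16 * K) * 2 ^ m" using K(1) by simp
    also have "\<dots> \<le> 2 ^ R * 2 ^ m" using R by (intro mult_right_mono) auto
    also have "\<dots> = real (2 ^ (R + m))" by (simp add: power_add)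
    finally show ?thesis using of_nat_le_iff by blast
  qed
  thus ?thesis by blast
qed

section \<open>Counting\<close>

lemma card_determined_off_point:
  assumes "\<And>b b'. b \<in> F \<Longrightarrow> b' \<in> F \<Longrightarrow> b - {p} = b' - {p}"
  shows "card F \<le> 2"
proof (cases "F = {}")
  case False
  then obtain b0 where b0: "b0 \<in> F" by blast
  have "F \<subseteq> {b0 - {p}, insert p b0}"
  proof
    fix b assume "b \<in> F"
    from assms[OF this b0] show "b \<in> {b0 - {p}, insert p b0}" by blast
  qed
  hence "card F \<le> card {b0 - {p}, insert p b0}" by (intro card_mono) auto
  also have "\<dots> \<le> 2" by (simp add: card_insert_if)
  finally show ?thesis .
qed simp

lemma card_fixed_trace:
  assumes "finite X" "A \<subseteq> X" "\<And>b b'. b \<in> F \<Longrightarrow> b' \<in> F \<Longrightarrow> b \<inter> A = b' \<inter> A" "F \<subseteq> Pow X"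
  shows "card F \<le> 2 ^ (card X - card A)"
proof -
  have "inj_on (\<lambda>b. b - A) F"
    using assms(3) by (intro inj_onI) (metis Int_Diff_Un)
  hence "card F \<le> card (Pow (X - A))"
    using assms by (intro card_inj_on_le) auto
  thus ?thesis using assms(1,2) by (simp add: card_Pow card_Diff_subset finite_subset)
qed

lemma card_pairs_le:
  assumes "finite A" "finite B" "\<And>a. a \<in> A \<Longrightarrow> card {b \<in> B. R a b} \<le> c"
  shows "card {(a, b) \<in> A \<times> B. R a b} \<le> card A * c"
proof -
  have "{(a, b) \<in> A \<times> B. R a b} = (SIGMA a:A. {b \<in> B. R a b})" by auto
  hence "card {(a, b) \<in> A \<times> B. R a b} = (\<Sum>a\<in>A. card {b \<in> B. R a b})"
    using assms by (simp add: card_SigmaI)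
  also have "\<dots> \<le> card A * c" using sum_bounded_above[OF assms(3)] by simp
  finally show ?thesis .
qed

lemma card_pairs_le':
  assumes "finite A" "finite B" "\<And>b. b \<in> B \<Longrightarrow> card {a \<in> A. R a b} \<le> c"
  shows "card {(a, b) \<in> A \<times> B. R a b} \<le> card B * c"
proof -
  have "{(a, b) \<in> A \<times> B. R a b} = prod.swap ` {(b, a) \<in> B \<times> A. R a b}" by force
  hence "card {(a, b) \<in> A \<times> B. R a b} = card {(b, a) \<in> B \<times> A. R a b}"
    by (simp add: card_image)
  thus ?thesis using card_pairs_le[OF assms(2,1), of "\<lambda>b a. R a b" c] assms(3) by simp
qed

text \<open>
  This is the union bound: if the uniformly random element \<open>w\<close> of \<open>X\<close> hits each point of \<open>P\<close> in at most
  \<open>c\<close> cases, then it hits some point of \<open>P\<close> in at most \<open>card P * c\<close> cases.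
\<close>

lemma card_hit_le:
  assumes "finite P" "\<And>y. y \<in> P \<Longrightarrow> card {w \<in> X. R w y} \<le> c" "finite X"
  shows "card {w \<in> X. \<exists>y\<in>P. R w y} \<le> card P * c"
proof -
  have "{w \<in> X. \<exists>y\<in>P. R w y} = (\<Union>y\<in>P. {w \<in> X. R w y})" by auto
  hence "card {w \<in> X. \<exists>y\<in>P. R w y} \<le> (\<Sum>y\<in>P. card {w \<in> X. R w y})"
    using card_UN_le[OF assms(1)] by simp
  also have "\<dots> \<le> card P * c" using sum_bounded_above[OF assms(2)] by simp
  finally show ?thesis .
qed

lemma geometric_tail: "(\<Sum>j=j0..m. 2 ^ (m - j)) * 2 ^ j0 \<le> 2 * (2 ^ m :: nat)"
proof (cases "j0 \<le> Suc m")
  case True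
  \<comment> \<open>The extra summand makes the induction go through; equality holds.\<close>
  have "(\<Sum>j=j0..m. 2 ^ (m - j)) * 2 ^ j0 + 2 ^ j0 \<le> 2 * (2 ^ m :: nat)"
    using True
  proof (induction m)
    case 0
    thus ?case by (cases j0) auto
  next
    case (Suc m)
    show ?case
    proof (cases "j0 = Suc (Suc m)")
      case False
      hence le: "j0 \<le> Suc m" using Suc.prems by simp
      have "(\<Sum>j=j0..Suc m. 2 ^ (Suc m - j)) = (2 * (\<Sum>j=j0..m. 2 ^ (m - j)) + 1 :: nat)"
        using le by (simp add: sum_distrib_left Suc_diff_le)
      hence "(\<Sum>j=j0..Suc m. 2 ^ (Suc m - j)) * 2 ^ j0 + 2 ^ j0
          = 2 * ((\<Sum>j=j0..m. 2 ^ (m - j)) * 2 ^ j0 + 2 ^ j0 :: nat)"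
        by (simp only: algebra_simps)
      thus ?thesis using Suc.IH[OF le] by simp
    qed simp
  qed
  thus ?thesis by linarith
qed simp

lemma power_of_two_between: "\<exists>j. a \<le> 2 ^ j \<and> 2 ^ j \<le> 2 * a + (1::nat)"
proof (induction a)
  case 0 thus ?case by (intro exI[of _ 0]) simp
next
  case (Suc a)
  then obtain j where j: "a \<le> 2 ^ j" "2 ^ j \<le> 2 * a + 1" by blast
  show ?case
  proof (cases "a = 2 ^ j")
    case True
    thus ?thesis by (intro exI[of _ "Suc j"]) simp
  next
    case False
    thus ?thesis using j by (intro exI[of _ j]) simp
  qed
qed

section \<open>Balls in Cayley graphs\<close>

primrec word_ball :: "('a, 'c) monoid_scheme \<Rightarrow> 'a set \<Rightarrow> nat \<Rightarrow> 'a set" where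
  "word_ball G S 0 = {\<one>\<^bsub>G\<^esub>}"
| "word_ball G S (Suc n) = word_ball G S n \<union> (word_ball G S n <#>\<^bsub>G\<^esub> S)"

lemma set_multI: "a \<in> A \<Longrightarrow> b \<in> B \<Longrightarrow> a \<otimes>\<^bsub>G\<^esub> b \<in> A <#>\<^bsub>G\<^esub> B"
  unfolding set_mult_def by blast

lemma card_set_mult_le:
  assumes "finite A" "finite B"
  shows "finite (A <#>\<^bsub>G\<^esub> B) \<and> card (A <#>\<^bsub>G\<^esub> B) \<le> card A * card B"
proof -
  have eq: "A <#>\<^bsub>G\<^esub> B = (\<lambda>(a, b). a \<otimes>\<^bsub>G\<^esub> b) ` (A \<times> B)" unfolding set_mult_def by auto
  show ?thesis unfolding eq using assms card_image_le[of "A \<times> B"] by (simp add: card_cartesian_product)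
qed

lemma word_ball_mono: "m \<le> n \<Longrightarrow> word_ball G S m \<subseteq> word_ball G S n"
  by (rule lift_Suc_mono_le) auto

lemma one_in_word_ball: "\<one>\<^bsub>G\<^esub> \<in> word_ball G S n"
  using word_ball_mono[of 0 n G S] by auto

lemma word_ball_finite_card:
  assumes "finite S"
  shows "finite (word_ball G S n) \<and> card (word_ball G S n) \<le> (card S + 1) ^ n"
proof (induction n)
  case 0 show ?case by simp
next
  case (Suc n)
  have "card (word_ball G S (Suc n)) \<le> card (word_ball G S n) + card (word_ball G S n <#>\<^bsub>G\<^esub> S)"
    by (simp add: card_Un_le)
  also have "\<dots> \<le> card (word_ball G S n) + card (word_ball G S n) * card S"
    using card_set_mult_le[of "word_ball G S n" S G] Suc assms by simp
  also have "\<dots> = card (word_ball G S n) * (card S + 1)" by simp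
  also have "\<dots> \<le> (card S + 1) ^ n * (card S + 1)" using Suc by (intro mult_right_mono) auto
  finally show ?case using Suc assms card_set_mult_le[of "word_ball G S n" S G] by (simp add: mult.commute)
qed

context group
begin

lemma word_ball_carrier: "S \<subseteq> carrier G \<Longrightarrow> word_ball G S n \<subseteq> carrier G"
  by (induction n) (auto simp: set_mult_def)

lemma word_ball_mult:
  assumes S: "S \<subseteq> carrier G" and x: "x \<in> word_ball G S m"
  shows "y \<in> word_ball G S n \<Longrightarrow> x \<otimes> y \<in> word_ball G S (m + n)"
proof (induction n arbitrary: y)
  case 0
  thus ?case using x word_ball_carrier[OF S, of m] by (auto simp: subset_iff)
next
  case (Suc n)
  from Suc.prems consider "y \<in> word_ball G S n" | z s where "z \<in> word_ball G S n" "s \<in> S" "y = z \<otimes> s"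
    by (auto simp: set_mult_def)
  thus ?case
  proof cases
    case 1 thus ?thesis using Suc.IH by simp
  next
    case 2
    have "x \<otimes> y = (x \<otimes> z) \<otimes> s"
      using 2 x word_ball_carrier[OF S] S by (auto simp: subset_iff m_assoc)
    thus ?thesis using Suc.IH[OF 2(1)] 2(2) by (auto intro: set_multI)
  qed
qed

lemma word_ball_generator: "S \<subseteq> carrier G \<Longrightarrow> s \<in> S \<Longrightarrow> s \<in> word_ball G S 1"
  using set_multI[of \<one> "{\<one>}" s S G] by (auto simp: subset_iff)

lemma word_ball_inv:
  assumes S: "S \<subseteq> carrier G" and sym: "\<forall>s\<in>S. inv s \<in> S"
  shows "x \<in> word_ball G S n \<Longrightarrow> inv x \<in> word_ball G S n"
proof (induction n arbitrary: x)
  case 0 thus ?case by simp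
next
  case (Suc n)
  from Suc.prems consider "x \<in> word_ball G S n" | z s where "z \<in> word_ball G S n" "s \<in> S" "x = z \<otimes> s"
    by (auto simp: set_mult_def)
  thus ?case
  proof cases
    case 1 thus ?thesis using Suc.IH by simp
  next
    case 2
    have "inv x = inv s \<otimes> inv z" using 2 word_ball_carrier[OF S] S
      by (auto simp: subset_iff inv_mult_group)
    moreover have "inv s \<in> word_ball G S 1" using 2 sym word_ball_generator[OF S] by blast
    ultimately show ?thesis using word_ball_mult[OF S, of "inv s" 1 "inv z" n] Suc.IH[OF 2(1)] by simp
  qed
qed

lemma generate_word_ball:
  assumes S: "S \<subseteq> carrier G" and sym: "\<forall>s\<in>S. inv s \<in> S" and x: "x \<in> generate G S"
  shows "\<exists>n. x \<in> word_ball G S n"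
  using x
proof induction
  case one thus ?case using one_in_word_ball by blast
next
  case (incl h) thus ?case using word_ball_generator[OF S] by blast
next
  case (inv h) thus ?case using word_ball_generator[OF S] sym by blast
next
  case (eng x y) thus ?case using word_ball_mult[OF S] by blast
qed

lemma finite_subset_word_ball:
  assumes gen: "symmetric_generating_set G S" and A: "finite A" "A \<subseteq> carrier G"
  shows "\<exists>n. A \<subseteq> word_ball G S n"
  using A
proof induction
  case (insert a A)
  then obtain n where n: "A \<subseteq> word_ball G S n" by auto
  obtain m where "a \<in> word_ball G S m"
    using generate_word_ball[of S a] insert gen unfolding symmetric_generating_set_def by auto
  hence "insert a A \<subseteq> word_ball G S (max m n)"
    using n word_ball_mono[of m "max m n" G S] word_ball_mono[of n "max m n" G S] by auto
  thus ?case by blast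
qed simp

lemma cayley_ball_eq_word_ball:
  assumes S: "S \<subseteq> carrier G"
  shows "cayley_ball G S n = word_ball G S n"
proof -
  have rel: "x \<in> word_ball G S k" if "(\<one>, x) \<in> cayley_edges G S ^^ k" for x k
    using that by (induction k arbitrary: x) (auto simp: cayley_edges_def intro!: set_multI)
  have rel': "\<exists>k\<le>n. (\<one>, x) \<in> cayley_edges G S ^^ k" if "x \<in> word_ball G S n" for x n
    using that
  proof (induction n arbitrary: x)
    case 0 thus ?case by simp
  next
    case (Suc n)
    from Suc.prems consider "x \<in> word_ball G S n" | z s where "z \<in> word_ball G S n" "s \<in> S" "x = z \<otimes> s"
      by (auto simp: set_mult_def)
    thus ?case
    proof cases
      case 1 thus ?thesis using Suc.IH le_SucI by blast
    next
      case 2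
      then obtain k where "k \<le> n" "(\<one>, z) \<in> cayley_edges G S ^^ k" using Suc.IH by blast
      moreover have "(z, x) \<in> cayley_edges G S"
        using 2 word_ball_carrier[OF S] unfolding cayley_edges_def by blast
      ultimately have "Suc k \<le> Suc n" "(\<one>, x) \<in> cayley_edges G S ^^ Suc k" by auto
      thus ?thesis by blast
    qed
  qed
  have "cayley_dist G S \<one> x \<le> enat n \<longleftrightarrow> (\<exists>k\<le>n. (\<one>, x) \<in> cayley_edges G S ^^ k)" for x
  proof
    let ?A = "{enat k | k. (\<one>, x) \<in> cayley_edges G S ^^ k}"
    assume le: "cayley_dist G S \<one> x \<le> enat n"
    have "?A \<noteq> {}"
    proof
      assume e: "?A = {}"
      show False using le unfolding cayley_dist_def e by (simp add: Inf_enat_def)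
    qed
    hence "Inf ?A \<in> ?A" by (metis (no_types, lifting) Inf_enat_def LeastI ex_in_conv)
    thus "\<exists>k\<le>n. (\<one>, x) \<in> cayley_edges G S ^^ k"
      using le unfolding cayley_dist_def by auto
  next
    assume "\<exists>k\<le>n. (\<one>, x) \<in> cayley_edges G S ^^ k"
    then obtain k where k: "k \<le> n" "(\<one>, x) \<in> cayley_edges G S ^^ k" by blast
    hence "cayley_dist G S \<one> x \<le> enat k" unfolding cayley_dist_def by (intro Inf_lower) auto
    thus "cayley_dist G S \<one> x \<le> enat n" using k(1) by (meson enat_ord_simps(1) order_trans)
  qed
  thus ?thesis unfolding cayley_ball_def
    using rel rel' word_ball_carrier[OF S] word_ball_mono[of _ n G S] by blast
qed

text \<open>
  If some sphere were empty, the balls would stop growing and the group would be finite. A shortest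
  word for a point of the sphere of radius \<open>m\<close> has its prefixes on different spheres.
\<close>

lemma exists_geodesic:
  assumes Q: "symmetric_generating_set G Q" "finite Q" and inf: "infinite (carrier G)"
  shows "\<exists>\<sigma>. \<sigma> 0 = \<one> \<and> (\<forall>i\<le>m. \<sigma> i \<in> carrier G) \<and> inj_on \<sigma> {..m} \<and>
    (\<forall>i<m. \<exists>q\<in>Q. \<sigma> (Suc i) = \<sigma> i \<otimes> q)"
proof -
  have QG: "Q \<subseteq> carrier G" and sym: "\<forall>s\<in>Q. inv s \<in> Q" and gen: "generate G Q = carrier G"
    using Q unfolding symmetric_generating_set_def by auto
  have nonempty: "\<exists>y\<in>word_ball G Q m. \<forall>j<m. y \<notin> word_ball G Q j" for m
  proof (rule ccontr)
    assume none: "\<not> ?thesis"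
    have "m \<noteq> 0"
    proof
      assume "m = 0"
      thus False using none one_in_word_ball[of G Q 0] by auto
    qed
    then obtain k where m: "m = Suc k" using not0_implies_Suc by blast
    have sub: "word_ball G Q (Suc k) \<subseteq> word_ball G Q k"
    proof
      fix y assume "y \<in> word_ball G Q (Suc k)"
      then obtain j where "j < Suc k" "y \<in> word_ball G Q j" using none unfolding m by blast
      thus "y \<in> word_ball G Q k" using word_ball_mono[of j k G Q] by auto
    qed
    have "word_ball G Q n \<subseteq> word_ball G Q k" for n
    proof (induction n)
      case 0 show ?case using one_in_word_ball by auto
    next
      case (Suc n)
      thus ?case using sub mono_set_mult[OF Suc, of Q Q] by auto
    qed
    hence "carrier G \<subseteq> word_ball G Q k" using generate_word_ball[OF QG sym] gen by blast
    thus False using word_ball_finite_card[OF Q(2), of G k] inf finite_subset by blast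
  qed
  have path: "\<exists>\<sigma>. \<sigma> 0 = \<one> \<and> \<sigma> m = y \<and> (\<forall>i\<le>m. \<sigma> i \<in> word_ball G Q i \<and> (\<forall>j<i. \<sigma> i \<notin> word_ball G Q j)) \<and>
      (\<forall>i<m. \<exists>q\<in>Q. \<sigma> (Suc i) = \<sigma> i \<otimes> q)"
    if "y \<in> word_ball G Q m" "\<forall>j<m. y \<notin> word_ball G Q j" for y m
    using that
  proof (induction m arbitrary: y)
    case 0
    thus ?case by (intro exI[of _ "\<lambda>_. \<one>"]) auto
  next
    case (Suc m)
    hence "y \<notin> word_ball G Q m" by blast
    then obtain x q where xq: "x \<in> word_ball G Q m" "q \<in> Q" "y = x \<otimes> q"
      using Suc.prems(1) by (auto simp: set_mult_def)
    have "x \<notin> word_ball G Q j" if "j < m" for j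
    proof
      assume "x \<in> word_ball G Q j"
      hence "y \<in> word_ball G Q (Suc j)" using xq by (auto intro: set_multI)
      thus False using Suc.prems(2) that by auto
    qed
    then obtain \<sigma> where \<sigma>: "\<sigma> 0 = \<one>" "\<sigma> m = x"
      "\<forall>i\<le>m. \<sigma> i \<in> word_ball G Q i \<and> (\<forall>j<i. \<sigma> i \<notin> word_ball G Q j)"
      "\<forall>i<m. \<exists>q\<in>Q. \<sigma> (Suc i) = \<sigma> i \<otimes> q"
      using Suc.IH[OF xq(1)] by blast
    show ?case
      using \<sigma> xq Suc.prems by (intro exI[of _ "\<sigma>(Suc m := y)"]) (auto simp: le_Suc_eq less_Suc_eq)
  qed
  obtain y where "y \<in> word_ball G Q m" "\<forall>j<m. y \<notin> word_ball G Q j" using nonempty[of m] by blast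
  from path[OF this] obtain \<sigma> where \<sigma>: "\<sigma> 0 = \<one>" "\<sigma> m = y"
      "\<forall>i\<le>m. \<sigma> i \<in> word_ball G Q i \<and> (\<forall>j<i. \<sigma> i \<notin> word_ball G Q j)"
      "\<forall>i<m. \<exists>q\<in>Q. \<sigma> (Suc i) = \<sigma> i \<otimes> q" by blast
  have "inj_on \<sigma> {..m}"
  proof (rule inj_onI)
    fix i j assume "i \<in> {..m}" "j \<in> {..m}" "\<sigma> i = \<sigma> j"
    thus "i = j" using \<sigma>(3) by (metis atMost_iff linorder_neqE_nat)
  qed
  moreover have "\<forall>i\<le>m. \<sigma> i \<in> carrier G" using \<sigma>(3) word_ball_carrier[OF QG] by blast
  ultimately show ?thesis using \<sigma> by blast
qed

end

lemma (in group) exists_symmetric_generating_set: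
  assumes "finitely_generated_group G"
  shows "\<exists>Q. finite Q \<and> \<one> \<in> Q \<and> symmetric_generating_set G Q"
proof -
  obtain S where S: "finite S" "S \<subseteq> carrier G" "generate G S = carrier G"
    using assms by (auto simp: finitely_generated_group_def)
  define Q where "Q = insert \<one> (S \<union> m_inv G ` S)"
  have Q: "Q \<subseteq> carrier G" using S by (auto simp: Q_def)
  have "carrier G \<subseteq> generate G Q" using mono_generate[of S Q] S by (auto simp: Q_def)
  hence "generate G Q = carrier G" using generate_incl[OF Q] by blast
  moreover have "\<forall>q\<in>Q. inv q \<in> Q" using S by (auto simp: Q_def subset_iff)
  ultimately show ?thesis
    using S Q by (intro exI[of _ Q]) (auto simp: Q_def symmetric_generating_set_def)
qed

section \<open>Fire along paths that avoid protected vertices\<close>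

abbreviation "protected_by W k \<equiv> (\<Union>i\<in>{1..k::nat}. W i)"

lemma fire_mono: "m \<le> n \<Longrightarrow> fire \<Gamma> S F0 W m \<subseteq> fire \<Gamma> S F0 W n"
  by (rule lift_Suc_mono_le) auto

text \<open>
  The number \<open>k\<close> is only an upper bound for the number of moves, and the set \<open>M\<close> constrains every vertex
  except the first, which is already on fire when the path is used.
\<close>

inductive reach :: "('a, 'c) monoid_scheme \<Rightarrow> 'a set \<Rightarrow> 'a set \<Rightarrow> nat \<Rightarrow> 'a \<Rightarrow> 'a \<Rightarrow> bool"
  for G T M where
  start: "reach G T M k x x"
| move: "reach G T M k x y \<Longrightarrow> t \<in> T \<Longrightarrow> y \<otimes>\<^bsub>G\<^esub> t \<in> M \<Longrightarrow> reach G T M (Suc k) x (y \<otimes>\<^bsub>G\<^esub> t)"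

lemma reach_weaken:
  "reach G T M k x y \<Longrightarrow> M \<subseteq> M' \<Longrightarrow> k \<le> k' \<Longrightarrow> reach G T M' k' x y"
proof (induction arbitrary: k' rule: reach.induct)
  case (move k x y t)
  then obtain l where "k' = Suc l" "k \<le> l" by (cases k') auto
  thus ?case using move by (auto intro: reach.move)
qed (rule reach.start)

lemma reach_trans: "reach G T M k y z \<Longrightarrow> reach G T M j x y \<Longrightarrow> reach G T M (j + k) x z"
proof (induction rule: reach.induct)
  case (start k y) thus ?case using reach_weaken by force
next
  case (move k y z t) thus ?case using reach.move by fastforce
qed

context group
begin

lemma fire_carrier: "S \<subseteq> carrier G \<Longrightarrow> F0 \<subseteq> carrier G \<Longrightarrow> fire G S F0 W n \<subseteq> carrier G"
  by (induction n) (auto simp: cayley_edges_def)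

text \<open>
  The intermediate vertices on a path of at most \<open>j\<close> generators from \<open>y\<close> to \<open>y u\<close> have distance at most
  \<open>j\<close> from \<open>y u\<close>. Enlarging the protected set by a ball of radius \<open>j\<close> therefore makes it enough to
  look at the endpoint.
\<close>

lemma fire_word_step:
  assumes S: "S \<subseteq> carrier G" and sym: "\<forall>s\<in>S. inv s \<in> S"
    and W: "protected_by W (a + j) \<subseteq> carrier G"
    and y: "y \<in> fire G S F0 W a" "y \<in> carrier G"
  shows "u \<in> word_ball G S j \<Longrightarrow> y \<otimes> u \<notin> protected_by W (a + j) <#> word_ball G S j
    \<Longrightarrow> y \<otimes> u \<in> fire G S F0 W (a + j)"
  using W
proof (induction j arbitrary: u)
  case 0 thus ?case using y by simp
next
  case (Suc j)
  have sub: "protected_by W (a + j) \<subseteq> protected_by W (a + Suc j)" by (intro UN_mono) auto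
  have carr: "protected_by W (a + j) \<subseteq> carrier G" using Suc.prems(3) sub by (rule subset_trans[rotated])
  from Suc.prems(1) consider "u \<in> word_ball G S j"
    | z s where "z \<in> word_ball G S j" "s \<in> S" "u = z \<otimes> s"
    by (auto simp: set_mult_def)
  thus ?case
  proof cases
    case 1
    have "y \<otimes> u \<notin> protected_by W (a + j) <#> word_ball G S j"
      using Suc.prems(2) mono_set_mult[OF sub, of "word_ball G S j" "word_ball G S (Suc j)" G] by auto
    thus ?thesis using Suc.IH[OF 1 _ carr] fire_mono[of "a + j" "a + Suc j"] by auto
  next
    case 2
    have c: "z \<in> carrier G" "s \<in> carrier G" using 2 S word_ball_carrier[OF S] by auto
    have "y \<otimes> z \<notin> protected_by W (a + j) <#> word_ball G S j"
    proof
      assume "y \<otimes> z \<in> protected_by W (a + j) <#> word_ball G S j"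
      then obtain w v where wv: "w \<in> protected_by W (a + j)" "v \<in> word_ball G S j" "y \<otimes> z = w \<otimes> v"
        unfolding set_mult_def by auto
      have "y \<otimes> u = w \<otimes> (v \<otimes> s)"
        using 2 c y wv carr word_ball_carrier[OF S, of j] by (auto simp: subset_iff simp flip: m_assoc)
      moreover have "v \<otimes> s \<in> word_ball G S (Suc j)" using wv(2) 2(2) by (auto intro: set_multI)
      moreover have "w \<in> protected_by W (a + Suc j)" using wv(1) sub by (rule subsetD[rotated])
      ultimately show False using Suc.prems(2) set_multI by metis
    qed
    hence yz: "y \<otimes> z \<in> fire G S F0 W (a + j)" using Suc.IH[OF 2(1) _ carr] by blast
    have "(y \<otimes> z, y \<otimes> u) \<in> cayley_edges G S"
    proof -
      have "y \<otimes> u = (y \<otimes> z) \<otimes> s" using 2 c y by (simp add: m_assoc)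
      thus ?thesis using 2 c y unfolding cayley_edges_def by blast
    qed
    moreover have "y \<otimes> u \<notin> protected_by W (a + Suc j)"
    proof
      assume p: "y \<otimes> u \<in> protected_by W (a + Suc j)"
      have "y \<otimes> u = (y \<otimes> u) \<otimes> \<one>" using 2 c y by simp
      hence "y \<otimes> u \<in> protected_by W (a + Suc j) <#> word_ball G S (Suc j)"
        using set_multI[OF p one_in_word_ball] by metis
      thus False using Suc.prems(2) by blast
    qed
    ultimately show ?thesis using yz by auto
  qed
qed

lemma fire_reach:
  assumes S: "S \<subseteq> carrier G" "\<forall>s\<in>S. inv s \<in> S" and F0: "F0 \<subseteq> carrier G"
    and W: "protected_by W (N * l) \<subseteq> carrier G"
    and avoid: "M \<inter> (protected_by W (N * l) <#> word_ball G S l) = {}"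
  shows "reach G (word_ball G S l) M k y z \<Longrightarrow> y \<in> fire G S F0 W (j * l) \<Longrightarrow> j + k \<le> N
    \<Longrightarrow> z \<in> fire G S F0 W ((j + k) * l)"
proof (induction rule: reach.induct)
  case (start k y)
  thus ?case using fire_mono[of "j * l" "(j + k) * l" G S F0 W] by auto
next
  case (move k y z t)
  have z: "z \<in> fire G S F0 W ((j + k) * l)" using move by simp
  have "(j + k) * l + l = (j + Suc k) * l" by simp
  also have "\<dots> \<le> N * l" using move.prems(2) by (rule mult_le_mono1)
  finally have le: "(j + k) * l + l \<le> N * l" .
  have sub: "protected_by W ((j + k) * l + l) \<subseteq> protected_by W (N * l)"
    using le by (intro UN_mono) auto
  have "z \<otimes> t \<notin> protected_by W ((j + k) * l + l) <#> word_ball G S l"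
    using avoid move.hyps mono_set_mult[OF sub, of "word_ball G S l" "word_ball G S l"] by blast
  moreover have "protected_by W ((j + k) * l + l) \<subseteq> carrier G" using sub W by blast
  ultimately have "z \<otimes> t \<in> fire G S F0 W ((j + k) * l + l)"
    using fire_word_step[OF S _ z] z fire_carrier[OF S(1) F0] move.hyps by blast
  thus ?case by (simp add: algebra_simps)
qed

end

section \<open>The wreath product\<close>

locale wreath = group G + H: group H for G (structure) and H :: "('b, 'd) monoid_scheme"
begin

abbreviation \<Gamma> where "\<Gamma> \<equiv> wreath_product H G"

definition lamps :: "('a \<Rightarrow> 'b) set" where
  "lamps = {L \<in> carrier G \<rightarrow>\<^sub>E carrier H. finite {s \<in> carrier G. L s \<noteq> \<one>\<^bsub>H\<^esub>}}"

definition shifted_mult :: "'a \<Rightarrow> ('a \<Rightarrow> 'b) \<Rightarrow> ('a \<Rightarrow> 'b) \<Rightarrow> 'a \<Rightarrow> 'b" where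
  "shifted_mult p L M = (\<lambda>s\<in>carrier G. L s \<otimes>\<^bsub>H\<^esub> M (inv p \<otimes> s))"

lemma carrier_wreath: "carrier \<Gamma> = carrier G \<times> lamps"
  by (simp add: wreath_product_def lamps_def)

lemma one_wreath: "\<one>\<^bsub>\<Gamma>\<^esub> = (\<one>, \<lambda>s\<in>carrier G. \<one>\<^bsub>H\<^esub>)"
  by (simp add: wreath_product_def)

lemma mult_wreath: "(p, L) \<otimes>\<^bsub>\<Gamma>\<^esub> (q, M) = (p \<otimes> q, shifted_mult p L M)"
  by (simp add: wreath_product_def shifted_mult_def)

lemma lampsD: "L \<in> lamps \<Longrightarrow> s \<in> carrier G \<Longrightarrow> L s \<in> carrier H"
  by (auto simp: lamps_def)

lemma lamps_eqI:
  "L \<in> lamps \<Longrightarrow> M \<in> lamps \<Longrightarrow> (\<And>s. s \<in> carrier G \<Longrightarrow> L s = M s) \<Longrightarrow> L = M"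
  by (auto simp: lamps_def PiE_def intro: extensionalityI)

lemma lampsI:
  assumes "\<And>s. s \<in> carrier G \<Longrightarrow> L s \<in> carrier H" "L \<in> extensional (carrier G)"
    "finite A" "\<And>s. s \<in> carrier G \<Longrightarrow> s \<notin> A \<Longrightarrow> L s = \<one>\<^bsub>H\<^esub>"
  shows "L \<in> lamps"
proof -
  have "{s \<in> carrier G. L s \<noteq> \<one>\<^bsub>H\<^esub>} \<subseteq> A" using assms(4) by blast
  thus ?thesis using assms finite_subset by (auto simp: lamps_def PiE_def)
qed

lemma lamps_support: "L \<in> lamps \<Longrightarrow> finite {s \<in> carrier G. L s \<noteq> \<one>\<^bsub>H\<^esub>}"
  by (simp add: lamps_def)

lemma shifted_mult_lamps:
  assumes p: "p \<in> carrier G" and L: "L \<in> lamps" and M: "M \<in> lamps"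
  shows "shifted_mult p L M \<in> lamps"
proof (rule lampsI)
  show "finite ({s \<in> carrier G. L s \<noteq> \<one>\<^bsub>H\<^esub>} \<union> (\<otimes>) p ` {s \<in> carrier G. M s \<noteq> \<one>\<^bsub>H\<^esub>})"
    using lamps_support[OF L] lamps_support[OF M] by simp
  fix s assume s: "s \<in> carrier G"
  show "shifted_mult p L M s \<in> carrier H"
    using p s lampsD[OF L] lampsD[OF M] by (simp add: shifted_mult_def)
  assume "s \<notin> {s \<in> carrier G. L s \<noteq> \<one>\<^bsub>H\<^esub>} \<union> (\<otimes>) p ` {s \<in> carrier G. M s \<noteq> \<one>\<^bsub>H\<^esub>}"
  moreover have "s = p \<otimes> (inv p \<otimes> s)" using p s by (simp flip: m_assoc)
  ultimately have "L s = \<one>\<^bsub>H\<^esub>" "M (inv p \<otimes> s) = \<one>\<^bsub>H\<^esub>" using p s by blast+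
  thus "shifted_mult p L M s = \<one>\<^bsub>H\<^esub>" using s by (simp add: shifted_mult_def)
qed (simp add: shifted_mult_def)

lemma wreath_group: "group \<Gamma>"
proof (rule groupI)
  have one: "(\<lambda>s\<in>carrier G. \<one>\<^bsub>H\<^esub>) \<in> lamps" by (rule lampsI[of _ "{}"]) auto
  thus "\<one>\<^bsub>\<Gamma>\<^esub> \<in> carrier \<Gamma>" by (simp add: carrier_wreath one_wreath)
  show "x \<otimes>\<^bsub>\<Gamma>\<^esub> y \<in> carrier \<Gamma>" if "x \<in> carrier \<Gamma>" "y \<in> carrier \<Gamma>" for x y
    using that by (auto simp: carrier_wreath mult_wreath shifted_mult_lamps)
  show "x \<otimes>\<^bsub>\<Gamma>\<^esub> y \<otimes>\<^bsub>\<Gamma>\<^esub> z = x \<otimes>\<^bsub>\<Gamma>\<^esub> (y \<otimes>\<^bsub>\<Gamma>\<^esub> z)"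
    if xyz: "x \<in> carrier \<Gamma>" "y \<in> carrier \<Gamma>" "z \<in> carrier \<Gamma>" for x y z
  proof -
    obtain p L q M r N where [simp]: "x = (p, L)" "y = (q, M)" "z = (r, N)" by (metis surj_pair)
    have c: "p \<in> carrier G" "q \<in> carrier G" "r \<in> carrier G" and l: "L \<in> lamps" "M \<in> lamps" "N \<in> lamps"
      using xyz by (auto simp: carrier_wreath)
    have "shifted_mult (p \<otimes> q) (shifted_mult p L M) N = shifted_mult p L (shifted_mult q M N)"
      using c lampsD[OF l(1)] lampsD[OF l(2)] lampsD[OF l(3)]
      by (auto simp: shifted_mult_def restrict_def fun_eq_iff H.m_assoc m_assoc inv_mult_group)
    thus ?thesis using c by (simp add: mult_wreath m_assoc)
  qed
  show "\<one>\<^bsub>\<Gamma>\<^esub> \<otimes>\<^bsub>\<Gamma>\<^esub> x = x" if x: "x \<in> carrier \<Gamma>" for x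
  proof -
    obtain p L where [simp]: "x = (p, L)" by (metis surj_pair)
    have c: "p \<in> carrier G" "L \<in> lamps" using x by (auto simp: carrier_wreath)
    have "shifted_mult \<one> (\<lambda>s\<in>carrier G. \<one>\<^bsub>H\<^esub>) L = L"
      using c one lampsD[OF c(2)] by (intro lamps_eqI shifted_mult_lamps) (auto simp: shifted_mult_def)
    thus ?thesis using c by (simp add: mult_wreath one_wreath)
  qed
  show "\<exists>y\<in>carrier \<Gamma>. y \<otimes>\<^bsub>\<Gamma>\<^esub> x = \<one>\<^bsub>\<Gamma>\<^esub>" if x: "x \<in> carrier \<Gamma>" for x
  proof -
    obtain p L where [simp]: "x = (p, L)" by (metis surj_pair)
    have c: "p \<in> carrier G" and L: "L \<in> lamps" using x by (auto simp: carrier_wreath)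
    define M where "M = (\<lambda>s\<in>carrier G. inv\<^bsub>H\<^esub> (L (p \<otimes> s)))"
    have "M \<in> lamps"
    proof (rule lampsI)
      show "finite ((\<otimes>) (inv p) ` {s \<in> carrier G. L s \<noteq> \<one>\<^bsub>H\<^esub>})" using lamps_support[OF L] by simp
      fix s assume s: "s \<in> carrier G"
      show "M s \<in> carrier H" using s c lampsD[OF L] by (simp add: M_def)
      have "s = inv p \<otimes> (p \<otimes> s)" using c s by (simp flip: m_assoc)
      moreover assume "s \<notin> (\<otimes>) (inv p) ` {s \<in> carrier G. L s \<noteq> \<one>\<^bsub>H\<^esub>}"
      ultimately have "L (p \<otimes> s) = \<one>\<^bsub>H\<^esub>" using c s by blast
      thus "M s = \<one>\<^bsub>H\<^esub>" using s by (simp add: M_def)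
    qed (simp add: M_def)
    moreover have "shifted_mult (inv p) M L = (\<lambda>s\<in>carrier G. \<one>\<^bsub>H\<^esub>)"
      using c lampsD[OF L] by (auto simp: shifted_mult_def M_def restrict_def fun_eq_iff)
    ultimately show ?thesis using c
      by (intro bexI[of _ "(inv p, M)"]) (auto simp: carrier_wreath mult_wreath one_wreath)
  qed
qed

sublocale W: group \<Gamma> by (rule wreath_group)

definition lamp :: "'a \<Rightarrow> 'b \<Rightarrow> 'a \<Rightarrow> 'b" where
  "lamp r u = (\<lambda>s\<in>carrier G. if s = r then u else \<one>\<^bsub>H\<^esub>)"

lemma lamp_lamps: "u \<in> carrier H \<Longrightarrow> lamp r u \<in> lamps"
  by (rule lampsI[of _ "{r}"]) (auto simp: lamp_def)

lemma lamps_upd: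
  assumes L: "L \<in> lamps" and p: "p \<in> carrier G" and u: "u \<in> carrier H"
  shows "L(p := u) \<in> lamps"
proof (rule lampsI)
  show "finite (insert p {s \<in> carrier G. L s \<noteq> \<one>\<^bsub>H\<^esub>})" using lamps_support[OF L] by simp
  show "L(p := u) \<in> extensional (carrier G)"
    using L p by (auto simp: lamps_def PiE_def extensional_def)
qed (use u lampsD[OF L] in auto)

text \<open>
  Right multiplication by \<open>(q, lamp r u)\<close> moves the lamplighter from \<open>p\<close> to \<open>p q\<close> and multiplies the
  lamp at \<open>p r\<close> by \<open>u\<close>. Thus \<open>r = \<one>\<close> changes the lamp at the old position, and \<open>r = q\<close> the lamp at the
  new one.
\<close>

lemma mult_lamp:
  assumes "p \<in> carrier G" "q \<in> carrier G" "r \<in> carrier G" "L \<in> lamps" "u \<in> carrier H"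
  shows "(p, L) \<otimes>\<^bsub>\<Gamma>\<^esub> (q, lamp r u) = (p \<otimes> q, L(p \<otimes> r := L (p \<otimes> r) \<otimes>\<^bsub>H\<^esub> u))"
proof -
  have "shifted_mult p L (lamp r u) = L(p \<otimes> r := L (p \<otimes> r) \<otimes>\<^bsub>H\<^esub> u)"
  proof (rule lamps_eqI)
    fix s assume s: "s \<in> carrier G"
    have "inv p \<otimes> s = r \<longleftrightarrow> s = p \<otimes> r" using assms s by (metis inv_solve_left)
    thus "shifted_mult p L (lamp r u) s = (L(p \<otimes> r := L (p \<otimes> r) \<otimes>\<^bsub>H\<^esub> u)) s"
      using assms s lampsD[OF assms(4)] by (auto simp: shifted_mult_def lamp_def)
  next
    show "shifted_mult p L (lamp r u) \<in> lamps"
      using assms by (intro shifted_mult_lamps lamp_lamps)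
    show "L(p \<otimes> r := L (p \<otimes> r) \<otimes>\<^bsub>H\<^esub> u) \<in> lamps"
      using assms lampsD[OF assms(4)] by (intro lamps_upd) auto
  qed
  thus ?thesis by (simp add: mult_wreath)
qed

end

section \<open>Tours that rewrite lamps\<close>

definition interpolate :: "('a \<Rightarrow> 'b) \<Rightarrow> ('a \<Rightarrow> 'b) \<Rightarrow> 'a set \<Rightarrow> 'a \<Rightarrow> 'b" where
  "interpolate L L' V = (\<lambda>s. if s \<in> V then L' s else L s)"

text \<open>
  These are the states met while the lamps are changed from \<open>L\<close> to \<open>L'\<close> in the order of \<open>\<tau>\<close>. The lamp at
  the current position is unrestricted because it may be in the middle of being rewritten; all the
  others have either their old or their new value, according to the number \<open>i\<close> of sites processed.
\<close>

definition tour_region :: "'a list \<Rightarrow> ('a \<Rightarrow> 'b) \<Rightarrow> ('a \<Rightarrow> 'b) \<Rightarrow> ('a \<times> ('a \<Rightarrow> 'b)) set" where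
  "tour_region \<tau> L L' =
     {(p, M). \<exists>i\<le>length \<tau>. \<forall>s. s \<noteq> p \<longrightarrow> M s = interpolate L L' (set (take i \<tau>)) s}"

lemma tour_region_Cons:
  "tour_region \<tau> (L(p := L' p)) L' \<subseteq> tour_region (p # \<tau>) L L'"
proof
  fix x assume "x \<in> tour_region \<tau> (L(p := L' p)) L'"
  then obtain q M i where x: "x = (q, M)" and i: "i \<le> length \<tau>"
    and M: "\<And>s. s \<noteq> q \<Longrightarrow> M s = interpolate (L(p := L' p)) L' (set (take i \<tau>)) s"
    unfolding tour_region_def by auto
  have "M s = interpolate L L' (set (take (Suc i) (p # \<tau>))) s" if "s \<noteq> q" for s
    using M[OF that] by (auto simp: interpolate_def)
  thus "x \<in> tour_region (p # \<tau>) L L'"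
    unfolding tour_region_def x using i by (auto intro!: exI[of _ "Suc i"])
qed

locale wreath_generators = wreath G H for G :: "('a, 'c) monoid_scheme" (structure)
    and H :: "('b, 'd) monoid_scheme" +
  fixes Q :: "'a set" and Q\<^sub>H :: "'b set"
  assumes Q_gen: "symmetric_generating_set G Q" and Q_finite: "finite Q" and one_Q: "\<one> \<in> Q"
    and QH_gen: "symmetric_generating_set H Q\<^sub>H" and QH_finite: "finite Q\<^sub>H"
begin

lemma Q_carrier: "Q \<subseteq> carrier G" and Q_inv: "\<forall>q\<in>Q. inv q \<in> Q"
  and QH_carrier: "Q\<^sub>H \<subseteq> carrier H" and QH_inv: "\<forall>u\<in>Q\<^sub>H. inv\<^bsub>H\<^esub> u \<in> Q\<^sub>H"
  using Q_gen QH_gen unfolding symmetric_generating_set_def by auto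

definition len :: "'b \<Rightarrow> nat" where
  "len u = (LEAST k. u \<in> word_ball H Q\<^sub>H k)"

lemma len_le: "u \<in> word_ball H Q\<^sub>H k \<Longrightarrow> len u \<le> k"
  unfolding len_def by (rule Least_le)

lemma word_ball_len:
  assumes "u \<in> carrier H" shows "u \<in> word_ball H Q\<^sub>H (len u)"
proof -
  have "u \<in> generate H Q\<^sub>H" using assms QH_gen by (simp add: symmetric_generating_set_def)
  then obtain n where "u \<in> word_ball H Q\<^sub>H n" using H.generate_word_ball[OF QH_carrier QH_inv] by blast
  thus ?thesis unfolding len_def by (rule LeastI)
qed

lemma len_mult: "u \<in> carrier H \<Longrightarrow> v \<in> carrier H \<Longrightarrow> len (u \<otimes>\<^bsub>H\<^esub> v) \<le> len u + len v"
  by (intro len_le H.word_ball_mult QH_carrier word_ball_len)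

lemma len_inv: "u \<in> carrier H \<Longrightarrow> len (inv\<^bsub>H\<^esub> u) \<le> len u"
  by (intro len_le H.word_ball_inv QH_carrier QH_inv word_ball_len)

lemma len_one: "len \<one>\<^bsub>H\<^esub> = 0"
  using len_le[of "\<one>\<^bsub>H\<^esub>" 0] by simp

abbreviation walk :: "'a list \<Rightarrow> bool" where
  "walk \<equiv> successively (\<lambda>p q. \<exists>t\<in>Q. q = p \<otimes> t)"

definition moves :: "('a \<times> ('a \<Rightarrow> 'b)) set" where
  "moves = (\<lambda>q. (q, lamp \<one> \<one>\<^bsub>H\<^esub>)) ` Q \<union> (\<lambda>u. (\<one>, lamp \<one> u)) ` Q\<^sub>H"

lemma reach_site:
  assumes T: "moves \<subseteq> T" and p: "p \<in> carrier G" and L: "L \<in> lamps"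
    and M: "\<And>L'. (\<And>s. s \<noteq> p \<Longrightarrow> L' s = L s) \<Longrightarrow> (p, L') \<in> M"
  shows "u \<in> word_ball H Q\<^sub>H k \<Longrightarrow> reach \<Gamma> T M k (p, L) (p, L(p := L p \<otimes>\<^bsub>H\<^esub> u))"
proof (induction k arbitrary: u)
  case 0
  hence "L(p := L p \<otimes>\<^bsub>H\<^esub> u) = L" using lampsD[OF L p] by auto
  thus ?case by (simp add: reach.start)
next
  case (Suc k)
  from Suc.prems consider "u \<in> word_ball H Q\<^sub>H k"
    | v w where "v \<in> word_ball H Q\<^sub>H k" "w \<in> Q\<^sub>H" "u = v \<otimes>\<^bsub>H\<^esub> w"
    by (auto simp: set_mult_def)
  thus ?case
  proof cases
    case 1 thus ?thesis using reach_weaken[OF Suc.IH[OF 1], of M "Suc k"] by auto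
  next
    case 2
    let ?L = "L(p := L p \<otimes>\<^bsub>H\<^esub> v)"
    have vw: "v \<in> carrier H" "w \<in> carrier H"
      using 2 H.word_ball_carrier[OF QH_carrier] QH_carrier by auto
    hence "?L \<in> lamps" using p lampsD[OF L p] by (intro lamps_upd L) auto
    hence eq: "(p, ?L) \<otimes>\<^bsub>\<Gamma>\<^esub> (\<one>, lamp \<one> w) = (p, L(p := L p \<otimes>\<^bsub>H\<^esub> u))"
      using mult_lamp[of p \<one> \<one> ?L w] p vw 2(3) lampsD[OF L p] by (simp add: H.m_assoc)
    have "(\<one>, lamp \<one> w) \<in> T" using T 2(2) unfolding moves_def by blast
    moreover have "(p, L(p := L p \<otimes>\<^bsub>H\<^esub> u)) \<in> M" by (rule M) simp
    ultimately show ?thesis using reach.move[OF Suc.IH[OF 2(1)], of "(\<one>, lamp \<one> w)", unfolded eq] by blast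
  qed
qed

text \<open>
  The walk is followed once, and at each of its sites the lamp is rewritten along a shortest word.
  A site that the walk visits again already has its new value and costs nothing the second time.
\<close>

lemma reach_tour:
  assumes T: "moves \<subseteq> T"
  shows "\<tau> \<noteq> [] \<Longrightarrow> walk \<tau> \<Longrightarrow> set \<tau> \<subseteq> carrier G \<Longrightarrow> L \<in> lamps \<Longrightarrow> L' \<in> lamps
    \<Longrightarrow> (\<And>s. s \<in> carrier G \<Longrightarrow> s \<notin> set \<tau> \<Longrightarrow> L s = L' s)
    \<Longrightarrow> reach \<Gamma> T (tour_region \<tau> L L')
          (length \<tau> + (\<Sum>s\<in>set \<tau>. len (inv\<^bsub>H\<^esub> (L s) \<otimes>\<^bsub>H\<^esub> L' s))) (hd \<tau>, L) (last \<tau>, L')"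
proof (induction \<tau> arbitrary: L)
  case Nil thus ?case by simp
next
  case (Cons p \<tau>)
  define c where "c L s = len (inv\<^bsub>H\<^esub> (L s) \<otimes>\<^bsub>H\<^esub> L' s)" for L s
  let ?L = "L(p := L' p)" and ?R = "tour_region (p # \<tau>) L L'"
  have p: "p \<in> carrier G" using Cons.prems by simp
  have Lp: "L p \<in> carrier H" "L' p \<in> carrier H" using Cons.prems p lampsD by blast+
  have L: "?L \<in> lamps" using lamps_upd Cons.prems p Lp by blast
  have "(p, M) \<in> ?R" if "\<And>s. s \<noteq> p \<Longrightarrow> M s = L s" for M
    unfolding tour_region_def interpolate_def using that by (auto intro!: exI[of _ 0])
  from reach_site[OF T p Cons.prems(4) this word_ball_len, of "inv\<^bsub>H\<^esub> (L p) \<otimes>\<^bsub>H\<^esub> L' p"]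
  have site: "reach \<Gamma> T ?R (c L p) (p, L) (p, ?L)"
    using Lp by (simp add: c_def flip: H.m_assoc)
  show ?case
  proof (cases "\<tau> = []")
    case True
    hence "?L = L'" using Cons.prems by (intro lamps_eqI L) auto
    thus ?thesis using True reach_weaken[OF site, of ?R "Suc (c L p)"] by (simp add: c_def)
  next
    case False
    obtain t where t: "t \<in> Q" "hd \<tau> = p \<otimes> t"
      using Cons.prems(2) False by (auto simp: successively_Cons)
    have tc: "t \<in> carrier G" using t Q_carrier by blast
    have "(p, ?L) \<otimes>\<^bsub>\<Gamma>\<^esub> (t, lamp \<one> \<one>\<^bsub>H\<^esub>) = (hd \<tau>, ?L)"
      using mult_lamp[OF p tc _ L, of \<one> "\<one>\<^bsub>H\<^esub>"] p Lp t(2) by simp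
    moreover have "(t, lamp \<one> \<one>\<^bsub>H\<^esub>) \<in> T" using T t(1) unfolding moves_def by blast
    moreover have "(hd \<tau>, ?L) \<in> ?R"
      unfolding tour_region_def interpolate_def by (auto intro!: exI[of _ 1])
    ultimately have st: "reach \<Gamma> T ?R (Suc (c L p)) (p, L) (hd \<tau>, ?L)"
      using reach.move[OF site] by metis
    have "reach \<Gamma> T (tour_region \<tau> ?L L') (length \<tau> + sum (c ?L) (set \<tau>)) (hd \<tau>, ?L) (last \<tau>, L')"
      unfolding c_def using Cons.prems False by (intro Cons.IH L) (auto simp: successively_Cons)
    hence "reach \<Gamma> T ?R (length \<tau> + sum (c ?L) (set \<tau>)) (hd \<tau>, ?L) (last \<tau>, L')"
      by (rule reach_weaken[OF _ tour_region_Cons order_refl])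
    from reach_trans[OF this st]
    have r: "reach \<Gamma> T ?R (Suc (c L p) + (length \<tau> + sum (c ?L) (set \<tau>))) (p, L) (last \<tau>, L')" .
    have "sum (c ?L) (set \<tau>) = sum (c ?L) (set \<tau> - {p})"
      using Lp by (intro sum.mono_neutral_right) (auto simp: c_def len_one)
    also have "\<dots> = sum (c L) (set \<tau> - {p})" by (intro sum.cong) (auto simp: c_def)
    finally have "c L p + sum (c ?L) (set \<tau>) = sum (c L) (set (p # \<tau>))"
      by (simp add: sum.insert_remove)
    hence "Suc (c L p) + (length \<tau> + sum (c ?L) (set \<tau>)) = length (p # \<tau>) + sum (c L) (set (p # \<tau>))"
      by simp
    with r have "reach \<Gamma> T ?R (length (p # \<tau>) + (\<Sum>s\<in>set (p # \<tau>). c L s)) (p, L) (last \<tau>, L')"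
      by (simp only:)
    with False show ?thesis unfolding c_def by (simp only: list.sel last.simps if_False)
  qed
qed

lemma walk_append:
  assumes "walk xs" "walk ys" "last xs = hd ys" "set xs \<subseteq> carrier G"
  shows "walk (xs @ ys)"
proof (cases "xs = []")
  case False
  hence "hd ys = last xs \<otimes> \<one>" using assms(3,4) last_in_set by (metis r_one subsetD)
  hence "\<exists>t\<in>Q. hd ys = last xs \<otimes> t" using one_Q by blast
  thus ?thesis using assms by (simp add: successively_append_iff)
qed (use assms in simp)

lemma walk_rev:
  assumes "walk xs" "set xs \<subseteq> carrier G" shows "walk (rev xs)"
proof -
  have "successively (\<lambda>p q. \<exists>t\<in>Q. p = q \<otimes> t) xs"
  proof (rule successively_mono[OF assms(1)])
    fix p q assume pq: "p \<in> set xs" "q \<in> set xs" "\<exists>t\<in>Q. q = p \<otimes> t"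
    then obtain t where t: "t \<in> Q" "q = p \<otimes> t" by blast
    hence "p = q \<otimes> inv t" using assms(2) pq Q_carrier by (auto simp: subset_iff m_assoc)
    thus "\<exists>t\<in>Q. p = q \<otimes> t" using t Q_inv by blast
  qed
  thus ?thesis by (simp add: successively_rev)
qed

lemma walk_translate:
  assumes "walk xs" "set xs \<subseteq> carrier G" "g \<in> carrier G" shows "walk (map ((\<otimes>) g) xs)"
  unfolding successively_map
proof (rule successively_mono[OF assms(1)])
  fix p q assume pq: "p \<in> set xs" "q \<in> set xs" "\<exists>t\<in>Q. q = p \<otimes> t"
  thus "\<exists>t\<in>Q. g \<otimes> q = g \<otimes> p \<otimes> t" using assms Q_carrier by (auto simp: subset_iff m_assoc)
qed

lemma exists_walk:
  assumes "g \<in> carrier G"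
  shows "\<exists>\<tau>. \<tau> \<noteq> [] \<and> walk \<tau> \<and> set \<tau> \<subseteq> carrier G \<and> hd \<tau> = \<one> \<and> last \<tau> = g"
proof -
  have "\<exists>\<tau>. \<tau> \<noteq> [] \<and> walk \<tau> \<and> set \<tau> \<subseteq> carrier G \<and> hd \<tau> = \<one> \<and> last \<tau> = g" if "g \<in> word_ball G Q n" for g n
    using that
  proof (induction n arbitrary: g)
    case 0
    thus ?case by (intro exI[of _ "[\<one>]"]) auto
  next
    case (Suc n)
    from Suc.prems consider "g \<in> word_ball G Q n" | z s where "z \<in> word_ball G Q n" "s \<in> Q" "g = z \<otimes> s"
      by (auto simp: set_mult_def)
    thus ?case
    proof cases
      case 1 thus ?thesis using Suc.IH by blast
    next
      case 2
      then obtain \<tau> where "\<tau> \<noteq> []" "walk \<tau>" "set \<tau> \<subseteq> carrier G" "hd \<tau> = \<one>" "last \<tau> = z"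
        using Suc.IH by blast
      moreover have "g \<in> carrier G" using 2 Q_carrier word_ball_carrier[OF Q_carrier] by auto
      ultimately show ?thesis using 2
        by (intro exI[of _ "\<tau> @ [g]"]) (auto simp: successively_append_iff)
    qed
  qed
  thus ?thesis using generate_word_ball[OF Q_carrier Q_inv, of g] assms Q_gen
    by (auto simp: symmetric_generating_set_def)
qed

lemma exists_covering_walk:
  assumes "finite A" "A \<subseteq> carrier G" "g \<in> carrier G"
  shows "\<exists>\<tau>. \<tau> \<noteq> [] \<and> walk \<tau> \<and> set \<tau> \<subseteq> carrier G \<and> hd \<tau> = \<one> \<and> last \<tau> = g \<and> A \<subseteq> set \<tau>"
  using assms
proof (induction A arbitrary: g)
  case empty thus ?case using exists_walk by auto
next
  case (insert a A)
  obtain \<tau>1 where 1: "\<tau>1 \<noteq> []" "walk \<tau>1" "set \<tau>1 \<subseteq> carrier G" "hd \<tau>1 = \<one>" "last \<tau>1 = a"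
    using exists_walk[of a] insert.prems by auto
  obtain \<tau>2 where 2: "\<tau>2 \<noteq> []" "walk \<tau>2" "set \<tau>2 \<subseteq> carrier G" "hd \<tau>2 = \<one>" "last \<tau>2 = g" "A \<subseteq> set \<tau>2"
    using insert.IH[of g] insert.prems by auto
  have "walk ((\<tau>1 @ rev \<tau>1) @ \<tau>2)"
    using 1 2 by (intro walk_append walk_rev) (auto simp: hd_rev last_rev)
  moreover have "a \<in> set \<tau>1" using 1 last_in_set by blast
  ultimately show ?case using 1 2
    by (intro exI[of _ "(\<tau>1 @ rev \<tau>1) @ \<tau>2"]) auto
qed

text \<open>
  This cost bounds both the walking and the writing needed to build \<open>x\<close>. The second clause sums over
  arbitrary finite sets instead of the support, because supports are not additive under the product.
\<close>

definition tour_cost_le :: "'a \<times> ('a \<Rightarrow> 'b) \<Rightarrow> nat \<Rightarrow> bool" where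
  "tour_cost_le x k \<longleftrightarrow>
     (\<exists>\<tau>. \<tau> \<noteq> [] \<and> walk \<tau> \<and> set \<tau> \<subseteq> carrier G \<and> hd \<tau> = \<one> \<and> last \<tau> = fst x \<and>
        length \<tau> \<le> k \<and> {s \<in> carrier G. snd x s \<noteq> \<one>\<^bsub>H\<^esub>} \<subseteq> set \<tau>) \<and>
     (\<forall>A. finite A \<and> A \<subseteq> carrier G \<longrightarrow> (\<Sum>s\<in>A. len (snd x s)) \<le> k)"

lemma tour_cost_le_mono: "tour_cost_le x k \<Longrightarrow> k \<le> l \<Longrightarrow> tour_cost_le x l"
  unfolding tour_cost_le_def by (meson order_trans)

lemma tour_cost_le_exists:
  assumes x: "x \<in> carrier \<Gamma>" shows "\<exists>k. tour_cost_le x k"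
proof -
  obtain g L where [simp]: "x = (g, L)" by (metis surj_pair)
  have g: "g \<in> carrier G" and L: "L \<in> lamps" using x by (auto simp: carrier_wreath)
  let ?D = "{s \<in> carrier G. L s \<noteq> \<one>\<^bsub>H\<^esub>}"
  obtain \<tau> where \<tau>: "\<tau> \<noteq> []" "walk \<tau>" "set \<tau> \<subseteq> carrier G" "hd \<tau> = \<one>" "last \<tau> = g" "?D \<subseteq> set \<tau>"
    using exists_covering_walk[OF lamps_support[OF L] _ g] by auto
  have "(\<Sum>s\<in>A. len (L s)) \<le> (\<Sum>s\<in>?D. len (L s))" if A: "finite A" "A \<subseteq> carrier G" for A
  proof -
    have "(\<Sum>s\<in>A. len (L s)) = (\<Sum>s\<in>A \<inter> ?D. len (L s))"
      using A by (intro sum.mono_neutral_right) (auto simp: len_one)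
    also have "\<dots> \<le> (\<Sum>s\<in>?D. len (L s))" using lamps_support[OF L] by (intro sum_mono2) auto
    finally show ?thesis .
  qed
  hence "tour_cost_le x (length \<tau> + (\<Sum>s\<in>?D. len (L s)))"
    unfolding tour_cost_le_def using \<tau> by (auto intro: trans_le_add2 intro!: exI[of _ \<tau>])
  thus ?thesis by blast
qed

lemma tour_cost_le_one: "tour_cost_le \<one>\<^bsub>\<Gamma>\<^esub> 1"
  unfolding tour_cost_le_def one_wreath by (auto simp: len_one subset_iff intro!: exI[of _ "[\<one>]"])

text \<open>
  A walk for \<open>x\<close> followed by the translate by \<open>x\<close> of a walk for \<open>y\<close> covers the support of the product.
\<close>

lemma tour_cost_le_mult:
  assumes xy: "x \<in> carrier \<Gamma>" "y \<in> carrier \<Gamma>" and cost: "tour_cost_le x k" "tour_cost_le y l"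
  shows "tour_cost_le (x \<otimes>\<^bsub>\<Gamma>\<^esub> y) (k + l)"
proof -
  obtain p L q M where [simp]: "x = (p, L)" "y = (q, M)" by (metis surj_pair)
  have p: "p \<in> carrier G" "q \<in> carrier G" and L: "L \<in> lamps" "M \<in> lamps"
    using xy by (auto simp: carrier_wreath)
  obtain \<tau>1 where 1: "\<tau>1 \<noteq> []" "walk \<tau>1" "set \<tau>1 \<subseteq> carrier G" "hd \<tau>1 = \<one>" "last \<tau>1 = p" "length \<tau>1 \<le> k"
      "{s \<in> carrier G. L s \<noteq> \<one>\<^bsub>H\<^esub>} \<subseteq> set \<tau>1"
    using cost(1) by (auto simp: tour_cost_le_def)
  obtain \<tau>2 where 2: "\<tau>2 \<noteq> []" "walk \<tau>2" "set \<tau>2 \<subseteq> carrier G" "hd \<tau>2 = \<one>" "last \<tau>2 = q" "length \<tau>2 \<le> l"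
      "{s \<in> carrier G. M s \<noteq> \<one>\<^bsub>H\<^esub>} \<subseteq> set \<tau>2"
    using cost(2) by (auto simp: tour_cost_le_def)
  let ?\<tau> = "\<tau>1 @ map ((\<otimes>) p) \<tau>2"
  have "walk ?\<tau>" using 1 2 p by (intro walk_append walk_translate) (auto simp: hd_map)
  moreover have "set ?\<tau> \<subseteq> carrier G" using 1 2 p by auto
  moreover have "{s \<in> carrier G. shifted_mult p L M s \<noteq> \<one>\<^bsub>H\<^esub>} \<subseteq> set ?\<tau>"
  proof
    fix s assume "s \<in> {s \<in> carrier G. shifted_mult p L M s \<noteq> \<one>\<^bsub>H\<^esub>}"
    hence s: "s \<in> carrier G" "L s \<otimes>\<^bsub>H\<^esub> M (inv p \<otimes> s) \<noteq> \<one>\<^bsub>H\<^esub>" by (auto simp: shifted_mult_def)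
    show "s \<in> set ?\<tau>"
    proof (cases "L s = \<one>\<^bsub>H\<^esub>")
      case True
      hence "inv p \<otimes> s \<in> set \<tau>2" using s p 2(7) by auto
      moreover have "s = p \<otimes> (inv p \<otimes> s)" using p s by (simp flip: m_assoc)
      ultimately show ?thesis by (metis Un_iff image_eqI set_append set_map)
    qed (use 1(7) s in auto)
  qed
  moreover have "(\<Sum>s\<in>A. len (shifted_mult p L M s)) \<le> k + l" if A: "finite A" "A \<subseteq> carrier G" for A
  proof -
    have inj: "inj_on ((\<otimes>) (inv p)) A"
    proof (rule inj_onI)
      fix s t assume "s \<in> A" "t \<in> A" "inv p \<otimes> s = inv p \<otimes> t"
      thus "s = t" using A p by (simp add: subset_iff Units_eq)
    qed
    have "(\<Sum>s\<in>A. len (shifted_mult p L M s)) \<le> (\<Sum>s\<in>A. len (L s) + len (M (inv p \<otimes> s)))"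
    proof (rule sum_mono)
      fix s assume "s \<in> A"
      hence "s \<in> carrier G" using A by blast
      thus "len (shifted_mult p L M s) \<le> len (L s) + len (M (inv p \<otimes> s))"
        using lampsD[OF L(1)] lampsD[OF L(2)] p by (simp add: shifted_mult_def len_mult)
    qed
    also have "\<dots> = (\<Sum>s\<in>A. len (L s)) + (\<Sum>s\<in>(\<otimes>) (inv p) ` A. len (M s))"
      using inj by (simp add: sum.distrib sum.reindex)
    also have "\<dots> \<le> k + l"
    proof (rule add_mono)
      have "finite ((\<otimes>) (inv p) ` A)" "(\<otimes>) (inv p) ` A \<subseteq> carrier G" using A p by auto
      thus "(\<Sum>s\<in>(\<otimes>) (inv p) ` A. len (M s)) \<le> l"
        using cost(2) unfolding tour_cost_le_def by auto
    qed (use cost(1) A in \<open>auto simp: tour_cost_le_def\<close>)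
    finally show ?thesis .
  qed
  moreover have "?\<tau> \<noteq> []" "hd ?\<tau> = \<one>" "last ?\<tau> = p \<otimes> q" "length ?\<tau> \<le> k + l"
    using 1 2 by (simp_all add: last_map)
  ultimately show ?thesis
    unfolding tour_cost_le_def \<open>x = (p, L)\<close> \<open>y = (q, M)\<close> mult_wreath fst_conv snd_conv by blast
qed

lemma tour_cost_word_ball:
  assumes S: "finite S" "S \<subseteq> carrier \<Gamma>"
  shows "\<exists>K. \<forall>n. \<forall>x\<in>word_ball \<Gamma> S n. tour_cost_le x (1 + K * n)"
proof -
  obtain \<kappa> where \<kappa>: "\<And>s. s \<in> S \<Longrightarrow> tour_cost_le s (\<kappa> s)"
    using tour_cost_le_exists S(2) by (metis subsetD)
  define K where "K = sum \<kappa> S"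
  have K: "tour_cost_le s K" if "s \<in> S" for s
    using tour_cost_le_mono[OF \<kappa>[OF that]] member_le_sum[OF that, of \<kappa>] S(1) unfolding K_def by simp
  have "\<forall>x\<in>word_ball \<Gamma> S n. tour_cost_le x (1 + K * n)" for n
  proof (induction n)
    case 0 thus ?case using tour_cost_le_one by simp
  next
    case (Suc n)
    show ?case
    proof
      fix x assume "x \<in> word_ball \<Gamma> S (Suc n)"
      then consider "x \<in> word_ball \<Gamma> S n" | z s where "z \<in> word_ball \<Gamma> S n" "s \<in> S" "x = z \<otimes>\<^bsub>\<Gamma>\<^esub> s"
        by (auto simp: set_mult_def)
      thus "tour_cost_le x (1 + K * Suc n)"
      proof cases
        case 1
        show ?thesis by (rule tour_cost_le_mono[OF Suc[rule_format, OF 1]]) simp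
      next
        case 2
        have c: "z \<in> carrier \<Gamma>" "s \<in> carrier \<Gamma>" using 2 S(2) W.word_ball_carrier[OF S(2)] by auto
        show ?thesis unfolding 2(3)
          by (rule tour_cost_le_mono[OF tour_cost_le_mult[OF c Suc[rule_format, OF 2(1)] K[OF 2(2)]]]) simp
      qed
    qed
  qed
  thus ?thesis by blast
qed

end

section \<open>Random trails\<close>

context wreath_generators
begin

definition pattern :: "'b \<Rightarrow> 'a set \<Rightarrow> 'a \<Rightarrow> 'b" where
  "pattern h b = (\<lambda>s\<in>carrier G. if s \<in> b then h else \<one>\<^bsub>H\<^esub>)"

text \<open>
  The state after \<open>i\<close> steps of the walk \<open>\<sigma>\<close> in which \<open>h\<close> is written at the visited sites that belong to
  \<open>b\<close>. Sites are counted from \<open>1\<close>, so that every trail starts at the identity.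
\<close>

definition trail :: "'b \<Rightarrow> (nat \<Rightarrow> 'a) \<Rightarrow> nat \<Rightarrow> 'a set \<Rightarrow> 'a \<times> ('a \<Rightarrow> 'b)" where
  "trail h \<sigma> i b = (\<sigma> i, pattern h (b \<inter> \<sigma> ` {1..i}))"

definition writing_moves :: "'b \<Rightarrow> ('a \<times> ('a \<Rightarrow> 'b)) set" where
  "writing_moves h = (\<lambda>(q, u). (q, lamp q u)) ` (Q \<times> {\<one>\<^bsub>H\<^esub>, h})"

definition simple_walk :: "(nat \<Rightarrow> 'a) \<Rightarrow> nat \<Rightarrow> bool" where
  "simple_walk \<sigma> m \<longleftrightarrow> \<sigma> 0 = \<one> \<and> (\<forall>i\<le>m. \<sigma> i \<in> carrier G) \<and> inj_on \<sigma> {..m} \<and>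
     (\<forall>i<m. \<exists>q\<in>Q. \<sigma> (Suc i) = \<sigma> i \<otimes> q)"

lemma pattern_lamps: "h \<in> carrier H \<Longrightarrow> finite b \<Longrightarrow> pattern h b \<in> lamps"
  by (rule lampsI[of _ b]) (auto simp: pattern_def)

lemma pattern_eq_iff:
  assumes "h \<noteq> \<one>\<^bsub>H\<^esub>" "s \<in> carrier G"
  shows "pattern h b s = pattern h b' s \<longleftrightarrow> (s \<in> b \<longleftrightarrow> s \<in> b')"
  using assms by (auto simp: pattern_def)

lemma trail_carrier:
  "h \<in> carrier H \<Longrightarrow> simple_walk \<sigma> m \<Longrightarrow> i \<le> m \<Longrightarrow> trail h \<sigma> i b \<in> carrier \<Gamma>"
  by (auto simp: trail_def carrier_wreath simple_walk_def intro!: pattern_lamps)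

lemma trail_0: "simple_walk \<sigma> m \<Longrightarrow> trail h \<sigma> 0 b = \<one>\<^bsub>\<Gamma>\<^esub>"
  by (simp add: trail_def one_wreath simple_walk_def pattern_def)

lemma trail_Suc:
  assumes h: "h \<in> carrier H" and \<sigma>: "simple_walk \<sigma> m" and i: "i < m"
  shows "\<exists>t\<in>writing_moves h. trail h \<sigma> (Suc i) b = trail h \<sigma> i b \<otimes>\<^bsub>\<Gamma>\<^esub> t"
proof -
  obtain q where q: "q \<in> Q" "\<sigma> (Suc i) = \<sigma> i \<otimes> q" using \<sigma> i by (auto simp: simple_walk_def)
  define u where "u = (if \<sigma> (Suc i) \<in> b then h else \<one>\<^bsub>H\<^esub>)"
  let ?L = "pattern h (b \<inter> \<sigma> ` {1..i})"
  have c: "\<sigma> i \<in> carrier G" "\<sigma> (Suc i) \<in> carrier G" "q \<in> carrier G" "u \<in> carrier H"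
    using \<sigma> i q Q_carrier h by (auto simp: simple_walk_def u_def)
  have new: "\<sigma> (Suc i) \<notin> \<sigma> ` {1..i}"
  proof
    assume "\<sigma> (Suc i) \<in> \<sigma> ` {1..i}"
    then obtain j where "1 \<le> j" "j \<le> i" "\<sigma> (Suc i) = \<sigma> j" by auto
    moreover have "inj_on \<sigma> {..m}" using \<sigma> by (simp add: simple_walk_def)
    ultimately show False using i inj_onD[of \<sigma> "{..m}" "Suc i" j] by auto
  qed
  have "pattern h (b \<inter> \<sigma> ` {1..Suc i}) = ?L(\<sigma> (Suc i) := ?L (\<sigma> (Suc i)) \<otimes>\<^bsub>H\<^esub> u)"
    using new c h by (auto simp: pattern_def u_def fun_eq_iff atLeastAtMostSuc_conv)
  moreover have "?L \<in> lamps" using h by (intro pattern_lamps) auto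
  ultimately have "trail h \<sigma> (Suc i) b = trail h \<sigma> i b \<otimes>\<^bsub>\<Gamma>\<^esub> (q, lamp q u)"
    unfolding trail_def using mult_lamp[of "\<sigma> i" q q ?L u] c q(2) by simp
  moreover have "(q, lamp q u) \<in> writing_moves h" using q(1) by (auto simp: writing_moves_def u_def)
  ultimately show ?thesis by blast
qed

lemma card_simple_walk: "simple_walk \<sigma> m \<Longrightarrow> i \<le> m \<Longrightarrow> card (\<sigma> ` {1..i}) = i"
  by (subst card_image) (auto simp: simple_walk_def elim: inj_on_subset)

text \<open>
  The state after \<open>i\<close> steps reveals which of the first \<open>i\<close> sites lie in \<open>b\<close>. For a random \<open>b\<close> each vertex
  is thus the \<open>i\<close>-th vertex of the trail with probability at most \<open>2\<^sup>-\<^sup>i\<close>.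
\<close>

lemma card_trail_fibre:
  assumes h: "h \<in> carrier H" "h \<noteq> \<one>\<^bsub>H\<^esub>" and \<sigma>: "simple_walk \<sigma> m" and i: "i \<le> m"
    and z: "z \<in> carrier \<Gamma>"
  shows "card {b \<in> Pow (\<sigma> ` {1..m}). z \<otimes>\<^bsub>\<Gamma>\<^esub> trail h \<sigma> i b = y} \<le> 2 ^ (m - i)"
proof -
  let ?F = "{b \<in> Pow (\<sigma> ` {1..m}). z \<otimes>\<^bsub>\<Gamma>\<^esub> trail h \<sigma> i b = y}"
  have trace: "b \<inter> \<sigma> ` {1..i} = b' \<inter> \<sigma> ` {1..i}" if "b \<in> ?F" "b' \<in> ?F" for b b'
  proof -
    have "z \<otimes>\<^bsub>\<Gamma>\<^esub> trail h \<sigma> i b = z \<otimes>\<^bsub>\<Gamma>\<^esub> trail h \<sigma> i b'" using that by simp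
    hence "trail h \<sigma> i b = trail h \<sigma> i b'"
      using z trail_carrier[OF h(1) \<sigma> i] by (simp add: W.Units_eq)
    hence eq: "pattern h (b \<inter> \<sigma> ` {1..i}) s = pattern h (b' \<inter> \<sigma> ` {1..i}) s" for s
      by (simp add: trail_def)
    have "s \<in> b \<longleftrightarrow> s \<in> b'" if "s \<in> \<sigma> ` {1..i}" for s
    proof -
      have "s \<in> carrier G" using that \<sigma> i by (auto simp: simple_walk_def)
      from iffD1[OF pattern_eq_iff[OF h(2) this] eq] that show ?thesis by simp
    qed
    thus ?thesis by blast
  qed
  have "\<sigma> ` {1..i} \<subseteq> \<sigma> ` {1..m}" using i by (intro image_mono) simp
  hence "card ?F \<le> 2 ^ (card (\<sigma> ` {1..m}) - card (\<sigma> ` {1..i}))"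
    by (rule card_fixed_trace[OF finite_imageI[OF finite_atLeastAtMost] _ trace]) (assumption | blast)+
  thus ?thesis using card_simple_walk[OF \<sigma>] i by simp
qed

lemma walk_simple_walk:
  assumes "simple_walk \<sigma> m" shows "walk (map \<sigma> [0..<Suc m])"
proof -
  have "walk (map \<sigma> [0..<Suc i])" if "i \<le> m" for i
    using that
  proof (induction i)
    case (Suc i)
    have "walk (map \<sigma> [0..<Suc i] @ [\<sigma> (Suc i)])"
      using Suc assms by (subst successively_append_iff) (auto simp: simple_walk_def last_map)
    thus ?case by simp
  qed simp
  thus ?thesis by blast
qed

text \<open>
  The set \<open>a\<close> encodes a random choice, and the assumption says that the lamps away from the current
  position \<open>p\<close> determine \<open>a\<close> except for the single bit \<open>r p\<close>. There are \<open>length \<tau> + 1\<close> stages of the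
  tour, and each leaves two choices for this bit.
\<close>

lemma card_region_fibre:
  assumes "\<And>a a' p M i. a \<in> Y \<Longrightarrow> a' \<in> Y
      \<Longrightarrow> (\<And>s. s \<noteq> p \<Longrightarrow> interpolate (f a) (f' a) (set (take i \<tau>)) s = interpolate (f a') (f' a') (set (take i \<tau>)) s)
      \<Longrightarrow> a - {r p} = a' - {r p}" and "finite Y"
  shows "card {a \<in> Y. y \<in> tour_region \<tau> (f a) (f' a)} \<le> (length \<tau> + 1) * 2"
proof -
  obtain p M where y: "y = (p, M)" by (metis surj_pair)
  let ?R = "\<lambda>a i. \<forall>s. s \<noteq> p \<longrightarrow> M s = interpolate (f a) (f' a) (set (take i \<tau>)) s"
  have "{a \<in> Y. y \<in> tour_region \<tau> (f a) (f' a)} = {a \<in> Y. \<exists>i\<in>{..length \<tau>}. ?R a i}"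
    unfolding y tour_region_def by auto
  moreover have "card {a \<in> Y. \<exists>i\<in>{..length \<tau>}. ?R a i} \<le> card {..length \<tau>} * 2"
  proof (rule card_hit_le)
    fix i
    show "card {a \<in> Y. ?R a i} \<le> 2"
    proof (rule card_determined_off_point)
      fix a a' assume a: "a \<in> {a \<in> Y. ?R a i}" "a' \<in> {a \<in> Y. ?R a i}"
      show "a - {r p} = a' - {r p}"
      proof (rule assms(1)[of a a' p i])
        fix s assume "s \<noteq> p"
        with a show "interpolate (f a) (f' a) (set (take i \<tau>)) s = interpolate (f a') (f' a') (set (take i \<tau>)) s"
          by fastforce
      qed (use a in auto)
    qed
  qed (use assms(2) in auto)
  ultimately show ?thesis by simp
qed

text \<open>
  Write \<open>x = (g, L)\<close>. The lamp configurations at the two ends are the pattern of \<open>b\<close> and \<open>L\<close> times the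
  pattern of \<open>c\<close> translated by \<open>g\<close>, and the sites of the two patterns may overlap. The path goes
  through the product of the two configurations (\<open>L1\<close> below). On the way to \<open>L1\<close>, each lamp is the
  value of the pattern of \<open>b\<close>, possibly multiplied by a factor that depends on \<open>c\<close> only; so \<open>c\<close>, the
  stage and the lamps determine \<open>b\<close> up to the bit at the current site. On the way from \<open>L1\<close> to the
  end, each lamp has a factor from \<open>c\<close>, possibly multiplied on the left by a factor that depends on \<open>b\<close>
  only, and the roles are exchanged. Removing the factor from \<open>b\<close> after the one from \<open>c\<close> has been
  written requires a conjugation by the lamp value, which is why the lengths of the lamps of \<open>x\<close>
  enter the bound.
\<close>

lemma middle_paths:
  assumes T: "moves \<subseteq> T" and h: "h \<in> carrier H" "h \<noteq> \<one>\<^bsub>H\<^esub>" and \<sigma>: "simple_walk \<sigma> m"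
    and x: "x \<in> carrier \<Gamma>" and cost: "tour_cost_le x k" and t: "t = 2 * Suc m + k"
  shows "\<exists>Reg.
    (\<forall>b\<in>Pow (\<sigma> ` {1..m}). \<forall>c\<in>Pow (\<sigma> ` {1..m}).
       reach \<Gamma> T (Reg b c) (3 * t + 3 * k + 4 * len h * t) (trail h \<sigma> m b) (x \<otimes>\<^bsub>\<Gamma>\<^esub> trail h \<sigma> m c)) \<and>
    (\<forall>y. card {(b, c) \<in> Pow (\<sigma> ` {1..m}) \<times> Pow (\<sigma> ` {1..m}). y \<in> Reg b c} \<le> 2 ^ m * (6 * t + 4))"
proof -
  define X where "X = \<sigma> ` {1..m}"
  have X: "finite X" "X \<subseteq> carrier G" "card X = m"
    using \<sigma> card_simple_walk[OF \<sigma>] by (auto simp: X_def simple_walk_def)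
  obtain g L where xgL: "x = (g, L)" by (metis surj_pair)
  have g: "g \<in> carrier G" and L: "L \<in> lamps" using x xgL by (auto simp: carrier_wreath)
  obtain \<tau>x where \<tau>x: "\<tau>x \<noteq> []" "walk \<tau>x" "set \<tau>x \<subseteq> carrier G" "hd \<tau>x = \<one>" "last \<tau>x = g"
      "length \<tau>x \<le> k" "{s \<in> carrier G. L s \<noteq> \<one>\<^bsub>H\<^esub>} \<subseteq> set \<tau>x"
    using cost xgL by (auto simp: tour_cost_le_def)
  have len_sum: "(\<Sum>s\<in>A. len (L s)) \<le> k" if "finite A" "A \<subseteq> carrier G" for A
    using cost xgL that by (auto simp: tour_cost_le_def)
  define \<rho> where "\<rho> = map \<sigma> [0..<Suc m]"
  have \<rho>: "\<rho> \<noteq> []" "walk \<rho>" "set \<rho> \<subseteq> carrier G" "hd \<rho> = \<one>" "last \<rho> = \<sigma> m" "length \<rho> = Suc m"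
    using \<sigma> walk_simple_walk[OF \<sigma>] by (auto simp: \<rho>_def simple_walk_def hd_map last_map hd_append simp del: upt_Suc)
  have X\<rho>: "X \<subseteq> set \<rho>" by (auto simp: X_def \<rho>_def simp del: upt_Suc)
  \<comment> \<open>From \<open>\<sigma> m\<close> back to \<open>\<one>\<close>, through the support of \<open>L\<close> to \<open>g\<close>, and out to \<open>g \<sigma>(m)\<close>: this covers the
      sites of both patterns and of \<open>L\<close>.\<close>
  define \<tau> where "\<tau> = rev \<rho> @ \<tau>x @ map ((\<otimes>) g) \<rho>"
  have walk_tail: "walk (\<tau>x @ map ((\<otimes>) g) \<rho>)"
    using \<tau>x \<rho> g by (intro walk_append walk_translate) (auto simp: hd_map)
  have \<tau>_walk: "walk \<tau>"
    unfolding \<tau>_def using \<tau>x \<rho> by (intro walk_append[OF walk_rev walk_tail]) (auto simp: last_rev)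
  have \<tau>_set: "set \<tau> \<subseteq> carrier G" using \<tau>x \<rho> g by (auto simp: \<tau>_def)
  have \<tau>_ends: "\<tau> \<noteq> []" "hd \<tau> = \<sigma> m" "last \<tau> = g \<otimes> \<sigma> m"
    using \<rho> by (auto simp: \<tau>_def hd_rev last_map)
  have \<tau>_len: "length \<tau> \<le> t" using \<tau>x \<rho> t by (simp add: \<tau>_def)
  have card_\<tau>: "card (set \<tau>) \<le> t" using card_length[of \<tau>] \<tau>_len by simp
  define L2 where "L2 c = shifted_mult g L (pattern h c)" for c
  define L1 where "L1 b c = shifted_mult \<one> (pattern h b) (L2 c)" for b c
  have fin: "finite b" if "b \<subseteq> X" for b using that X(1) finite_subset by blast
  have lamps: "pattern h b \<in> lamps" "L2 c \<in> lamps" "L1 b c \<in> lamps" if "b \<subseteq> X" "c \<subseteq> X" for b c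
    unfolding L1_def L2_def using that fin g L h by (auto intro!: shifted_mult_lamps pattern_lamps)
  have L2: "L2 c s = L s \<otimes>\<^bsub>H\<^esub> pattern h c (inv g \<otimes> s)" if "s \<in> carrier G" for c s
    using that by (simp add: L2_def shifted_mult_def)
  have L1: "L1 b c s = pattern h b s \<otimes>\<^bsub>H\<^esub> L2 c s" if "s \<in> carrier G" for b c s
    using that by (simp add: L1_def shifted_mult_def)
  have pH: "pattern h b s \<in> carrier H" "len (pattern h b s) \<le> len h" if "s \<in> carrier G" for b s
    using that h by (auto simp: pattern_def len_one)
  have L2H: "L2 c s \<in> carrier H" "len (L2 c s) \<le> len (L s) + len h" if "s \<in> carrier G" for c s
  proof -
    have s': "inv g \<otimes> s \<in> carrier G" using that g by simp
    show "L2 c s \<in> carrier H" using L2[OF that] lampsD[OF L that] pH[OF s'] by simp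
    have "len (L2 c s) \<le> len (L s) + len (pattern h c (inv g \<otimes> s))"
      unfolding L2[OF that] using lampsD[OF L that] pH[OF s'] by (intro len_mult)
    also have "\<dots> \<le> len (L s) + len h" using pH[OF s'] by simp
    finally show "len (L2 c s) \<le> len (L s) + len h" .
  qed
  have sumL: "(\<Sum>s\<in>set \<tau>. len (L s)) \<le> k" using \<tau>_set by (intro len_sum) auto
  have sumh: "(\<Sum>s\<in>set \<tau>. len h) \<le> len h * t" using card_\<tau> by simp
  \<comment> \<open>The second tour walks \<open>\<tau>\<close> backwards to remove \<open>b\<close> and returns, since it has to end where it began.\<close>
  define Reg where "Reg b c = tour_region \<tau> (pattern h b) (L1 b c) \<union> tour_region (rev \<tau> @ \<tau>) (L1 b c) (L2 c)" for b c
  have "reach \<Gamma> T (Reg b c) (3 * t + 3 * k + 4 * len h * t) (trail h \<sigma> m b) (x \<otimes>\<^bsub>\<Gamma>\<^esub> trail h \<sigma> m c)"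
    if bc: "b \<subseteq> X" "c \<subseteq> X" for b c
  proof -
    have same1: "pattern h b s = L1 b c s" if s: "s \<in> carrier G" "s \<notin> set \<tau>" for s
    proof -
      have "inv g \<otimes> s \<notin> c"
      proof
        assume "inv g \<otimes> s \<in> c"
        hence "inv g \<otimes> s \<in> set \<rho>" using bc X\<rho> by blast
        moreover have "s = g \<otimes> (inv g \<otimes> s)" using g s by (simp flip: m_assoc)
        ultimately have "s \<in> set (map ((\<otimes>) g) \<rho>)" by (metis image_eqI set_map)
        thus False using s by (simp add: \<tau>_def)
      qed
      moreover have "L s = \<one>\<^bsub>H\<^esub>" using s \<tau>x(7) by (auto simp: \<tau>_def)
      ultimately have "L2 c s = \<one>\<^bsub>H\<^esub>" using s g by (simp add: L2 pattern_def)
      thus ?thesis using L1[OF s(1)] pH[OF s(1)] by simp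
    qed
    have cost1: "len (inv\<^bsub>H\<^esub> (pattern h b s) \<otimes>\<^bsub>H\<^esub> L1 b c s) \<le> len (L s) + len h" if "s \<in> carrier G" for s
      using pH[OF that] L2H[OF that] L1[OF that] by (simp flip: H.m_assoc)
    have "(\<Sum>s\<in>set \<tau>. len (inv\<^bsub>H\<^esub> (pattern h b s) \<otimes>\<^bsub>H\<^esub> L1 b c s)) \<le> (\<Sum>s\<in>set \<tau>. len (L s) + len h)"
      using cost1 \<tau>_set by (intro sum_mono) auto
    also have "\<dots> \<le> k + len h * t" using sumL sumh unfolding sum.distrib by (rule add_mono)
    finally have sum1: "(\<Sum>s\<in>set \<tau>. len (inv\<^bsub>H\<^esub> (pattern h b s) \<otimes>\<^bsub>H\<^esub> L1 b c s)) \<le> k + len h * t" .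
    have r1: "reach \<Gamma> T (Reg b c) (t + (k + len h * t)) (\<sigma> m, pattern h b) (g \<otimes> \<sigma> m, L1 b c)"
      using reach_weaken[OF reach_tour[OF T \<tau>_ends(1) \<tau>_walk \<tau>_set lamps(1,3)[OF bc] same1],
          of "Reg b c" "t + (k + len h * t)"] sum1 \<tau>_len \<tau>_ends
      by (auto simp: Reg_def)
    let ?\<tau> = "rev \<tau> @ \<tau>"
    have w2: "?\<tau> \<noteq> []" "walk ?\<tau>" "set ?\<tau> \<subseteq> carrier G" "hd ?\<tau> = g \<otimes> \<sigma> m" "last ?\<tau> = g \<otimes> \<sigma> m"
      "set ?\<tau> = set \<tau>"
      using \<tau>_walk \<tau>_set \<tau>_ends by (auto simp: hd_rev last_rev intro!: walk_append walk_rev)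
    have same2: "L1 b c s = L2 c s" if s: "s \<in> carrier G" "s \<notin> set ?\<tau>" for s
    proof -
      have "s \<notin> b" using s bc X\<rho> by (auto simp: \<tau>_def)
      thus ?thesis using s L1[OF s(1)] L2H[OF s(1)] by (simp add: pattern_def)
    qed
    have cost2: "len (inv\<^bsub>H\<^esub> (L1 b c s) \<otimes>\<^bsub>H\<^esub> L2 c s) \<le> (len (L s) + len (L s)) + (len h + len h + len h)"
      if s: "s \<in> carrier G" for s
    proof -
      let ?p = "pattern h b s" and ?l = "L2 c s"
      have c: "?p \<in> carrier H" "?l \<in> carrier H" using pH[OF s] L2H[OF s] by auto
      have "inv\<^bsub>H\<^esub> (L1 b c s) \<otimes>\<^bsub>H\<^esub> ?l = inv\<^bsub>H\<^esub> ?l \<otimes>\<^bsub>H\<^esub> (inv\<^bsub>H\<^esub> ?p \<otimes>\<^bsub>H\<^esub> ?l)"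
        using c L1[OF s] by (simp add: H.inv_mult_group H.m_assoc)
      hence "len (inv\<^bsub>H\<^esub> (L1 b c s) \<otimes>\<^bsub>H\<^esub> ?l) \<le> len (inv\<^bsub>H\<^esub> ?l) + (len (inv\<^bsub>H\<^esub> ?p) + len ?l)"
        using c len_mult[of "inv\<^bsub>H\<^esub> ?l" "inv\<^bsub>H\<^esub> ?p \<otimes>\<^bsub>H\<^esub> ?l"] len_mult[of "inv\<^bsub>H\<^esub> ?p" ?l] by simp
      thus ?thesis
        using len_inv[OF c(1)] len_inv[OF c(2)] pH(2)[OF s, of b] L2H(2)[OF s, of c] by linarith
    qed
    have "(\<Sum>s\<in>set ?\<tau>. len (inv\<^bsub>H\<^esub> (L1 b c s) \<otimes>\<^bsub>H\<^esub> L2 c s))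
        \<le> (\<Sum>s\<in>set \<tau>. (len (L s) + len (L s)) + (len h + len h + len h))"
      unfolding w2(6) using cost2 \<tau>_set by (intro sum_mono) auto
    also have "\<dots> \<le> 2 * k + 3 * (len h * t)"
      using sumL sumh unfolding sum.distrib by linarith
    finally have sum2: "(\<Sum>s\<in>set ?\<tau>. len (inv\<^bsub>H\<^esub> (L1 b c s) \<otimes>\<^bsub>H\<^esub> L2 c s)) \<le> 2 * k + 3 * (len h * t)" .
    have "reach \<Gamma> T (Reg b c) (2 * t + (2 * k + 3 * (len h * t))) (hd ?\<tau>, L1 b c) (last ?\<tau>, L2 c)"
    proof (rule reach_weaken[OF reach_tour[OF T w2(1-3) lamps(3,2)[OF bc] same2]])
      show "length ?\<tau> + (\<Sum>s\<in>set ?\<tau>. len (inv\<^bsub>H\<^esub> (L1 b c s) \<otimes>\<^bsub>H\<^esub> L2 c s)) \<le> 2 * t + (2 * k + 3 * (len h * t))"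
        using sum2 \<tau>_len by (intro add_mono) auto
    qed (auto simp: Reg_def)
    hence r2: "reach \<Gamma> T (Reg b c) (2 * t + (2 * k + 3 * (len h * t))) (g \<otimes> \<sigma> m, L1 b c) (g \<otimes> \<sigma> m, L2 c)"
      using w2(4,5) by simp
    have e: "t + (k + len h * t) + (2 * t + (2 * k + 3 * (len h * t))) = 3 * t + 3 * k + 4 * len h * t"
      by simp
    have "trail h \<sigma> m b = (\<sigma> m, pattern h b)" "trail h \<sigma> m c = (\<sigma> m, pattern h c)"
      using bc by (auto simp: trail_def X_def Int_absorb2)
    thus ?thesis using reach_trans[OF r2 r1] unfolding e by (simp add: xgL mult_wreath L2_def)
  qed
  moreover have "card {(b, c) \<in> Pow X \<times> Pow X. y \<in> Reg b c} \<le> 2 ^ m * (6 * t + 4)" for y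
  proof -
    have finP: "finite (Pow X)" "card (Pow X) = 2 ^ m" using X by (auto simp: card_Pow)
    have k1: "card {b \<in> Pow X. y \<in> tour_region \<tau> (pattern h b) (L1 b c)} \<le> (length \<tau> + 1) * 2" for c
    proof (rule card_region_fibre[where r = id])
      fix b b' p i
      assume b: "b \<in> Pow X" "b' \<in> Pow X" and eq: "\<And>s. s \<noteq> p \<Longrightarrow>
        interpolate (pattern h b) (L1 b c) (set (take i \<tau>)) s = interpolate (pattern h b') (L1 b' c) (set (take i \<tau>)) s"
      have "s \<in> b \<longleftrightarrow> s \<in> b'" if "s \<in> X" "s \<noteq> p" for s
      proof -
        have s: "s \<in> carrier G" using that X by blast
        have "pattern h b s = pattern h b' s"
          using eq[OF that(2)] pH(1)[OF s] L2H(1)[OF s]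
          by (auto simp: interpolate_def L1[OF s] split: if_splits)
        thus ?thesis using pattern_eq_iff[OF h(2) s] by blast
      qed
      thus "b - {id p} = b' - {id p}" using b by auto
    qed (rule finP)
    have c1: "card {(b, c) \<in> Pow X \<times> Pow X. y \<in> tour_region \<tau> (pattern h b) (L1 b c)} \<le> 2 ^ m * ((length \<tau> + 1) * 2)"
      by (rule card_pairs_le'[OF finP(1) finP(1), unfolded finP(2)], rule k1)
    have k2: "card {c \<in> Pow X. y \<in> tour_region (rev \<tau> @ \<tau>) (L1 b c) (L2 c)} \<le> (length (rev \<tau> @ \<tau>) + 1) * 2" for b
    proof (rule card_region_fibre[where r = "\<lambda>p. inv g \<otimes> p"])
      fix c c' p i
      assume c: "c \<in> Pow X" "c' \<in> Pow X" and eq: "\<And>s. s \<noteq> p \<Longrightarrow>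
        interpolate (L1 b c) (L2 c) (set (take i (rev \<tau> @ \<tau>))) s = interpolate (L1 b c') (L2 c') (set (take i (rev \<tau> @ \<tau>))) s"
      have "s \<in> c \<longleftrightarrow> s \<in> c'" if "s \<in> X" "s \<noteq> inv g \<otimes> p" for s
      proof -
        have s: "s \<in> carrier G" using that X by blast
        have gs: "g \<otimes> s \<in> carrier G" and gs_inv: "inv g \<otimes> (g \<otimes> s) = s" using s g by (simp_all flip: m_assoc)
        have "g \<otimes> s \<noteq> p" using that(2) gs_inv by metis
        hence "L2 c (g \<otimes> s) = L2 c' (g \<otimes> s)"
          using eq[of "g \<otimes> s"] pH(1)[OF gs] L2H(1)[OF gs]
          by (auto simp: interpolate_def L1[OF gs] H.Units_eq split: if_splits)
        hence "pattern h c s = pattern h c' s"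
          using lampsD[OF L gs] pH(1)[OF s] by (simp add: L2[OF gs] gs_inv H.Units_eq)
        thus ?thesis using pattern_eq_iff[OF h(2) s] by blast
      qed
      thus "c - {inv g \<otimes> p} = c' - {inv g \<otimes> p}" using c by auto
    qed (rule finP)
    have c2: "card {(b, c) \<in> Pow X \<times> Pow X. y \<in> tour_region (rev \<tau> @ \<tau>) (L1 b c) (L2 c)} \<le> 2 ^ m * ((length (rev \<tau> @ \<tau>) + 1) * 2)"
      by (rule card_pairs_le[OF finP(1) finP(1), unfolded finP(2)], rule k2)
    have "{(b, c) \<in> Pow X \<times> Pow X. y \<in> Reg b c} =
        {(b, c) \<in> Pow X \<times> Pow X. y \<in> tour_region \<tau> (pattern h b) (L1 b c)} \<union>
        {(b, c) \<in> Pow X \<times> Pow X. y \<in> tour_region (rev \<tau> @ \<tau>) (L1 b c) (L2 c)}"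
      by (auto simp: Reg_def)
    hence "card {(b, c) \<in> Pow X \<times> Pow X. y \<in> Reg b c} \<le> 2 ^ m * ((length \<tau> + 1) * 2) + 2 ^ m * ((length (rev \<tau> @ \<tau>) + 1) * 2)"
      using order_trans[OF card_Un_le add_mono[OF c1 c2]] by simp
    also have "\<dots> = 2 ^ m * (6 * length \<tau> + 4)" by (simp add: algebra_simps)
    also have "\<dots> \<le> 2 ^ m * (6 * t + 4)" using \<tau>_len by simp
    finally show ?thesis .
  qed
  ultimately show ?thesis unfolding X_def by (intro exI[of _ Reg]) simp
qed

end

section \<open>How far the fire spreads\<close>

context wreath_generators
begin

lemma trail_word_ball:
  assumes S: "S \<subseteq> carrier \<Gamma>" and h: "h \<in> carrier H" and \<sigma>: "simple_walk \<sigma> m"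
    and l: "writing_moves h \<subseteq> word_ball \<Gamma> S l"
  shows "i \<le> m \<Longrightarrow> trail h \<sigma> i b \<in> word_ball \<Gamma> S (i * l)"
proof (induction i)
  case 0 thus ?case using trail_0[OF \<sigma>] by simp
next
  case (Suc i)
  obtain t where "t \<in> writing_moves h" "trail h \<sigma> (Suc i) b = trail h \<sigma> i b \<otimes>\<^bsub>\<Gamma>\<^esub> t"
    using trail_Suc[OF h \<sigma>, of i b] Suc.prems by auto
  thus ?case using W.word_ball_mult[OF S, of "trail h \<sigma> i b" "i * l" t l] Suc l
    by (auto simp: add.commute)
qed

text \<open>
  The unit of time is \<open>l\<close> steps of the fire. The bound \<open>start\<close> concerns the trail of \<open>b\<close>, the bound
  \<open>middle\<close> the passage to the translated trail of \<open>c\<close>, and \<open>tail\<close> the return along the latter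
  while it is at least \<open>j0\<close> moves away from \<open>x\<close>. On each of these parts at most a
  quarter of the pairs \<open>(b, c)\<close> give a path that meets a protected vertex, hence some pair avoids them all.
  During the last \<open>j0\<close> moves the path is so close to \<open>x\<close> that \<open>far\<close> applies.
\<close>

lemma far_points_burn:
  assumes S: "S \<subseteq> carrier \<Gamma>" "\<forall>s\<in>S. inv\<^bsub>\<Gamma>\<^esub> s \<in> S"
    and h: "h \<in> carrier H" "h \<noteq> \<one>\<^bsub>H\<^esub>" and l: "moves \<union> writing_moves h \<subseteq> word_ball \<Gamma> S l"
    and W: "\<And>k. protected_by W k \<subseteq> carrier \<Gamma>"
    and P: "\<And>k. P k = protected_by W (k * l) <#>\<^bsub>\<Gamma>\<^esub> word_ball \<Gamma> S l"
      "\<And>k. finite (P k)" "\<And>k. card (P k) \<le> p k"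
    and F0: "F0 = word_ball \<Gamma> S (R * l)"
    and \<sigma>: "simple_walk \<sigma> m" and R: "R \<le> m"
    and start: "4 * (\<Sum>i=1..m - R. p i * 2 ^ (m - R - i)) \<le> 2 ^ m"
    and x: "x \<in> carrier \<Gamma>" "tour_cost_le x k" and t: "t = 2 * Suc m + k"
    and N: "(m - R) + (3 * t + 3 * k + 4 * len h * t) + m \<le> N"
    and middle: "4 * (p N * (6 * t + 4)) < 2 ^ m"
    and tail: "8 * p N \<le> 2 ^ j0" and far: "x \<notin> P N <#>\<^bsub>\<Gamma>\<^esub> word_ball \<Gamma> S (j0 * l)"
  shows "\<exists>n. x \<in> fire \<Gamma> S F0 W n"
proof -
  let ?T = "word_ball \<Gamma> S l" and ?e = "trail h \<sigma>"
  define X where "X = \<sigma> ` {1..m}"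
  have X: "finite (Pow X)" "card (Pow X) = 2 ^ m"
    using card_simple_walk[OF \<sigma>, of m] by (auto simp: X_def card_Pow)
  define \<Omega> where "\<Omega> = Pow X \<times> Pow X"
  have \<Omega>: "finite \<Omega>" "card \<Omega> = 2 ^ m * 2 ^ m" using X by (auto simp: \<Omega>_def card_cartesian_product)
  have e: "?e i b \<in> carrier \<Gamma>" if "i \<le> m" for i b using trail_carrier[OF h(1) \<sigma> that] .
  have moves: "moves \<subseteq> ?T" and writing: "writing_moves h \<subseteq> ?T" using l by auto
  obtain Reg where Reg: "\<And>b c. b \<in> Pow X \<Longrightarrow> c \<in> Pow X \<Longrightarrow>
        reach \<Gamma> ?T (Reg b c) (3 * t + 3 * k + 4 * len h * t) (?e m b) (x \<otimes>\<^bsub>\<Gamma>\<^esub> ?e m c)"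
      "\<And>y. card {(b, c) \<in> Pow X \<times> Pow X. y \<in> Reg b c} \<le> 2 ^ m * (6 * t + 4)"
    using middle_paths[OF moves h \<sigma> x t] unfolding X_def by blast
  \<comment> \<open>The pairs whose path is blocked on the first, middle and last part.\<close>
  define B1 where "B1 i = {(b, c) \<in> \<Omega>. \<exists>y\<in>P i. ?e (R + i) b = y}" for i
  define B2 where "B2 = {w \<in> \<Omega>. \<exists>y\<in>P N. y \<in> Reg (fst w) (snd w)}"
  define B3 where "B3 j = {(b, c) \<in> \<Omega>. \<exists>y\<in>P N. x \<otimes>\<^bsub>\<Gamma>\<^esub> ?e j c = y}" for j
  have B1: "card (B1 i) \<le> 2 ^ m * (p i * 2 ^ (m - R - i))" if i: "i \<in> {1..m - R}" for i
    unfolding B1_def \<Omega>_def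
  proof (rule card_pairs_le'[OF X(1) X(1), unfolded X(2)])
    fix c
    have "card {b \<in> Pow X. \<exists>y\<in>P i. ?e (R + i) b = y} \<le> card (P i) * 2 ^ (m - R - i)"
    proof (rule card_hit_le[OF P(2)])
      fix y
      have Ri: "R + i \<le> m" using i R by auto
      show "card {b \<in> Pow X. ?e (R + i) b = y} \<le> 2 ^ (m - R - i)"
        using card_trail_fibre[OF h \<sigma> Ri W.one_closed, of y] e[OF Ri] by (simp add: X_def)
    qed (rule X)
    also have "\<dots> \<le> p i * 2 ^ (m - R - i)" using P(3) by (intro mult_right_mono) auto
    finally show "card {b \<in> Pow X. \<exists>y\<in>P i. ?e (R + i) b = y} \<le> p i * 2 ^ (m - R - i)" .
  qed
  have B2: "card B2 \<le> p N * (2 ^ m * (6 * t + 4))"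
  proof -
    have "card B2 \<le> card (P N) * (2 ^ m * (6 * t + 4))"
      unfolding B2_def
    proof (rule card_hit_le[OF P(2)])
      fix y
      have "{w \<in> \<Omega>. y \<in> Reg (fst w) (snd w)} = {(b, c) \<in> Pow X \<times> Pow X. y \<in> Reg b c}"
        by (auto simp: \<Omega>_def)
      thus "card {w \<in> \<Omega>. y \<in> Reg (fst w) (snd w)} \<le> 2 ^ m * (6 * t + 4)" using Reg(2) by simp
    qed (rule \<Omega>)
    also have "\<dots> \<le> p N * (2 ^ m * (6 * t + 4))" using P(3) by (intro mult_right_mono) auto
    finally show ?thesis .
  qed
  have B3: "card (B3 j) \<le> 2 ^ m * (p N * 2 ^ (m - j))" if j: "j \<in> {j0..m}" for j
    unfolding B3_def \<Omega>_def
  proof (rule card_pairs_le[OF X(1) X(1), unfolded X(2)])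
    fix b
    have "card {c \<in> Pow X. \<exists>y\<in>P N. x \<otimes>\<^bsub>\<Gamma>\<^esub> ?e j c = y} \<le> card (P N) * 2 ^ (m - j)"
    proof (rule card_hit_le[OF P(2)])
      fix y
      show "card {c \<in> Pow X. x \<otimes>\<^bsub>\<Gamma>\<^esub> ?e j c = y} \<le> 2 ^ (m - j)"
        using card_trail_fibre[OF h \<sigma> _ x(1), of j y] j by (simp add: X_def)
    qed (rule X)
    also have "\<dots> \<le> p N * 2 ^ (m - j)" using P(3) by (intro mult_right_mono) auto
    finally show "card {c \<in> Pow X. \<exists>y\<in>P N. x \<otimes>\<^bsub>\<Gamma>\<^esub> ?e j c = y} \<le> p N * 2 ^ (m - j)" .
  qed
  define Bad where "Bad = (\<Union>i\<in>{1..m - R}. B1 i) \<union> B2 \<union> (\<Union>j\<in>{j0..m}. B3 j)"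
  have "card Bad \<le> card (\<Union>i\<in>{1..m - R}. B1 i) + card B2 + card (\<Union>j\<in>{j0..m}. B3 j)"
    unfolding Bad_def by (meson add_le_mono1 card_Un_le order_trans)
  moreover have "4 * card (\<Union>i\<in>{1..m - R}. B1 i) \<le> 2 ^ m * 2 ^ m"
  proof -
    have "card (\<Union>i\<in>{1..m - R}. B1 i) \<le> (\<Sum>i=1..m - R. card (B1 i))" by (rule card_UN_le) simp
    also have "\<dots> \<le> (\<Sum>i=1..m - R. 2 ^ m * (p i * 2 ^ (m - R - i)))" using B1 by (rule sum_mono)
    also have "\<dots> = 2 ^ m * (\<Sum>i=1..m - R. p i * 2 ^ (m - R - i))" by (simp only: sum_distrib_left)
    finally have "4 * card (\<Union>i\<in>{1..m - R}. B1 i) \<le> 2 ^ m * (4 * (\<Sum>i=1..m - R. p i * 2 ^ (m - R - i)))"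
      by simp
    also have "\<dots> \<le> 2 ^ m * 2 ^ m" using start by (intro mult_left_mono) auto
    finally show ?thesis .
  qed
  moreover have "4 * card B2 < 2 ^ m * 2 ^ m"
  proof -
    have "4 * card B2 \<le> 4 * (p N * (2 ^ m * (6 * t + 4)))" using B2 by (rule mult_left_mono) simp
    also have "\<dots> = 2 ^ m * (4 * (p N * (6 * t + 4)))" by (simp only: mult.left_commute)
    also have "\<dots> < 2 ^ m * 2 ^ m" using middle by (intro mult_strict_left_mono) auto
    finally show ?thesis .
  qed
  moreover have "4 * card (\<Union>j\<in>{j0..m}. B3 j) \<le> 2 ^ m * 2 ^ m"
  proof -
    have "card (\<Union>j\<in>{j0..m}. B3 j) \<le> (\<Sum>j=j0..m. card (B3 j))" by (rule card_UN_le) simp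
    also have "\<dots> \<le> (\<Sum>j=j0..m. 2 ^ m * (p N * 2 ^ (m - j)))" using B3 by (rule sum_mono)
    also have "\<dots> = 2 ^ m * (p N * (\<Sum>j=j0..m. 2 ^ (m - j)))" by (simp only: sum_distrib_left)
    finally have le: "card (\<Union>j\<in>{j0..m}. B3 j) \<le> 2 ^ m * (p N * (\<Sum>j=j0..m. 2 ^ (m - j)))" .
    have "8 * p N * (\<Sum>j=j0..m. 2 ^ (m - j)) \<le> 2 ^ j0 * (\<Sum>j=j0..m. 2 ^ (m - j))"
      using tail by (rule mult_right_mono) simp
    also have "\<dots> \<le> 2 * 2 ^ m" using geometric_tail[of m j0] by (simp only: mult.commute)
    finally have "4 * (p N * (\<Sum>j=j0..m. 2 ^ (m - j))) \<le> 2 ^ m" by (simp only: mult.assoc)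
    hence "2 ^ m * (4 * (p N * (\<Sum>j=j0..m. 2 ^ (m - j)))) \<le> 2 ^ m * 2 ^ m" by (intro mult_left_mono) auto
    with le show ?thesis by linarith
  qed
  ultimately have "card Bad < card \<Omega>" using \<Omega>(2) by linarith
  moreover have "Bad \<subseteq> \<Omega>" by (auto simp: Bad_def B1_def B2_def B3_def)
  ultimately obtain b c where bc: "(b, c) \<in> \<Omega>" "(b, c) \<notin> Bad" by (metis less_irrefl subrelI subset_antisym)
  have start_free: "?e (R + i) b \<notin> P i" if "i \<in> {1..m - R}" for i
    using bc that unfolding Bad_def B1_def by blast
  have middle_free: "Reg b c \<inter> P N = {}"
    using bc unfolding Bad_def B2_def by auto
  have end_free: "x \<otimes>\<^bsub>\<Gamma>\<^esub> ?e j c \<notin> P N" if j: "j \<le> m" for j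
  proof (cases "j0 \<le> j")
    case True
    thus ?thesis using bc j unfolding Bad_def B3_def by auto
  next
    case False
    show ?thesis
    proof
      assume inP: "x \<otimes>\<^bsub>\<Gamma>\<^esub> ?e j c \<in> P N"
      have "?e j c \<in> word_ball \<Gamma> S (j * l)" using trail_word_ball[OF S(1) h(1) \<sigma> writing j] .
      hence "inv\<^bsub>\<Gamma>\<^esub> (?e j c) \<in> word_ball \<Gamma> S (j * l)" using W.word_ball_inv[OF S] by blast
      moreover have "word_ball \<Gamma> S (j * l) \<subseteq> word_ball \<Gamma> S (j0 * l)"
        using False by (intro word_ball_mono mult_right_mono) auto
      ultimately have "(x \<otimes>\<^bsub>\<Gamma>\<^esub> ?e j c) \<otimes>\<^bsub>\<Gamma>\<^esub> inv\<^bsub>\<Gamma>\<^esub> (?e j c) \<in> P N <#>\<^bsub>\<Gamma>\<^esub> word_ball \<Gamma> S (j0 * l)"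
        using inP by (intro set_multI) auto
      thus False using far x(1) e[OF j] by (simp add: W.m_assoc)
    qed
  qed
  have F0c: "F0 \<subseteq> carrier \<Gamma>" unfolding F0 by (rule W.word_ball_carrier[OF S(1)])
  have "?e (R + i) b \<in> fire \<Gamma> S F0 W (i * l)" if "i \<le> m - R" for i
    using that
  proof (induction i)
    case 0
    thus ?case using trail_word_ball[OF S(1) h(1) \<sigma> writing R] by (simp add: F0)
  next
    case (Suc i)
    have "R + i < m" using Suc.prems by simp
    then obtain s where s: "s \<in> ?T" "?e (R + Suc i) b = ?e (R + i) b \<otimes>\<^bsub>\<Gamma>\<^esub> s"
      using trail_Suc[OF h(1) \<sigma>, of "R + i" b] writing by auto
    have "reach \<Gamma> ?T {?e (R + Suc i) b} (Suc 0) (?e (R + i) b) (?e (R + Suc i) b)"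
      unfolding s(2) using s(1) by (intro reach.move reach.start) auto
    moreover have "{?e (R + Suc i) b} \<inter> (protected_by W (Suc i * l) <#>\<^bsub>\<Gamma>\<^esub> ?T) = {}"
      using start_free[of "Suc i"] Suc.prems unfolding P(1) by simp
    ultimately show ?case
      using W.fire_reach[OF S F0c W, of "{?e (R + Suc i) b}" "Suc i" l "Suc 0" "?e (R + i) b" _ i] Suc
      by simp
  qed
  from this[of "m - R"] have burn1: "?e m b \<in> fire \<Gamma> S F0 W ((m - R) * l)" using R by simp
  have PN: "Reg b c \<inter> (protected_by W (N * l) <#>\<^bsub>\<Gamma>\<^esub> ?T) = {}" using middle_free P(1) by simp
  have burn2: "x \<otimes>\<^bsub>\<Gamma>\<^esub> ?e m c \<in> fire \<Gamma> S F0 W ((m - R + (3 * t + 3 * k + 4 * len h * t)) * l)"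
    using bc(1) by (intro W.fire_reach[OF S F0c W PN Reg(1) burn1]) (use N in \<open>auto simp: \<Omega>_def\<close>)
  define E where "E = {x \<otimes>\<^bsub>\<Gamma>\<^esub> ?e j c | j. j \<le> m}"
  have "reach \<Gamma> ?T E i (x \<otimes>\<^bsub>\<Gamma>\<^esub> ?e m c) (x \<otimes>\<^bsub>\<Gamma>\<^esub> ?e (m - i) c)" if "i \<le> m" for i
    using that
  proof (induction i)
    case 0 show ?case by (simp add: reach.start)
  next
    case (Suc i)
    define j where "j = m - Suc i"
    have j: "m - i = Suc j" "j < m" using Suc.prems by (auto simp: j_def)
    obtain s where s: "s \<in> ?T" "?e (Suc j) c = ?e j c \<otimes>\<^bsub>\<Gamma>\<^esub> s"
      using trail_Suc[OF h(1) \<sigma> j(2), of c] writing by blast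
    have sc: "s \<in> carrier \<Gamma>" using s(1) W.word_ball_carrier[OF S(1)] by blast
    have "(x \<otimes>\<^bsub>\<Gamma>\<^esub> ?e (Suc j) c) \<otimes>\<^bsub>\<Gamma>\<^esub> inv\<^bsub>\<Gamma>\<^esub> s = x \<otimes>\<^bsub>\<Gamma>\<^esub> ?e j c"
      unfolding s(2) using x(1) sc e[of j c] j(2) by (simp add: W.m_assoc)
    moreover have "inv\<^bsub>\<Gamma>\<^esub> s \<in> ?T" using W.word_ball_inv[OF S s(1)] .
    moreover have "x \<otimes>\<^bsub>\<Gamma>\<^esub> ?e j c \<in> E" using j(2) by (auto simp: E_def)
    ultimately show ?case
      using reach.move[of \<Gamma> ?T E i "x \<otimes>\<^bsub>\<Gamma>\<^esub> ?e m c" "x \<otimes>\<^bsub>\<Gamma>\<^esub> ?e (Suc j) c" "inv\<^bsub>\<Gamma>\<^esub> s"] Suc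
      by (simp add: j(1) flip: j_def)
  qed
  from this[of m] have "reach \<Gamma> ?T E m (x \<otimes>\<^bsub>\<Gamma>\<^esub> ?e m c) x"
    using trail_0[OF \<sigma>, of h c] x(1) by simp
  moreover have "E \<inter> (protected_by W (N * l) <#>\<^bsub>\<Gamma>\<^esub> ?T) = {}"
    using end_free unfolding P(1) E_def by blast
  ultimately show ?thesis
    using W.fire_reach[OF S F0c W, of E N l m "x \<otimes>\<^bsub>\<Gamma>\<^esub> ?e m c" x
        "m - R + (3 * t + 3 * k + 4 * len h * t)"] burn2 N
    by blast
qed

lemma exists_simple_walk:
  assumes "infinite (carrier G)" shows "\<exists>\<sigma>. simple_walk \<sigma> m"
  using exists_geodesic[OF Q_gen Q_finite assms, of m] by (simp add: simple_walk_def)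

lemma moves_finite_carrier:
  assumes h: "h \<in> carrier H"
  shows "finite (moves \<union> writing_moves h)" "moves \<union> writing_moves h \<subseteq> carrier \<Gamma>"
proof -
  show "finite (moves \<union> writing_moves h)"
    unfolding moves_def writing_moves_def using Q_finite QH_finite by simp
  show "moves \<union> writing_moves h \<subseteq> carrier \<Gamma>"
    using h Q_carrier QH_carrier
    by (auto simp: moves_def writing_moves_def carrier_wreath subset_iff intro!: lamp_lamps)
qed

text \<open>
  The \<open>2\<^sup>m\<close> trails of length \<open>m\<close> have different endpoints.
\<close>

lemma card_word_ball_ge:
  assumes S: "S \<subseteq> carrier \<Gamma>" "finite S" and h: "h \<in> carrier H" "h \<noteq> \<one>\<^bsub>H\<^esub>"
    and l: "writing_moves h \<subseteq> word_ball \<Gamma> S l" and inf: "infinite (carrier G)"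
  shows "2 ^ m \<le> card (word_ball \<Gamma> S (m * l))"
proof -
  obtain \<sigma> where \<sigma>: "simple_walk \<sigma> m" using exists_simple_walk[OF inf] by blast
  define X where "X = \<sigma> ` {1..m}"
  have X: "finite (Pow X)" "card (Pow X) = 2 ^ m"
    using card_simple_walk[OF \<sigma>, of m] by (auto simp: X_def card_Pow)
  have "Pow X = {b \<in> Pow X. \<exists>y\<in>word_ball \<Gamma> S (m * l). trail h \<sigma> m b = y}"
    using trail_word_ball[OF S(1) h(1) \<sigma> l] by auto
  also have "card \<dots> \<le> card (word_ball \<Gamma> S (m * l)) * 1"
  proof (rule card_hit_le)
    fix y
    show "card {b \<in> Pow X. trail h \<sigma> m b = y} \<le> 1"
      using card_trail_fibre[OF h \<sigma> order_refl W.one_closed, of y] trail_carrier[OF h(1) \<sigma> order_refl]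
      by (simp add: X_def)
  qed (use X word_ball_finite_card[OF S(2)] in auto)
  finally show ?thesis using X(2) by simp
qed

text \<open>
  The number \<open>j0\<close> is chosen of the order of the logarithm of the number of protected vertices. Then a
  ball of radius \<open>j0 * l\<close> has size polynomial in that number, hence still subexponential.
\<close>

lemma unburnt_subexponential:
  assumes inf: "infinite (carrier G)" and h: "h \<in> carrier H" "h \<noteq> \<one>\<^bsub>H\<^esub>"
    and S: "finite S" "symmetric_generating_set \<Gamma> S" and f: "subexp f"
  shows "\<exists>F0 U n1. finite F0 \<and> F0 \<subseteq> carrier \<Gamma> \<and> subexp U \<and>
    (\<forall>W. allowed_strategy \<Gamma> S f F0 W \<longrightarrow>
      (\<forall>n\<ge>n1. card (unburnt \<Gamma> S F0 W \<inter> cayley_ball \<Gamma> S n) \<le> U n))"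
proof -
  have SG: "S \<subseteq> carrier \<Gamma>" "\<forall>s\<in>S. inv\<^bsub>\<Gamma>\<^esub> s \<in> S"
    using S(2) by (auto simp: symmetric_generating_set_def)
  have ball: "finite (word_ball \<Gamma> S n)" "card (word_ball \<Gamma> S n) \<le> (card S + 1) ^ n" for n
    using word_ball_finite_card[OF S(1), of \<Gamma> n] by auto
  obtain l where l: "moves \<union> writing_moves h \<subseteq> word_ball \<Gamma> S l"
    using W.finite_subset_word_ball[OF S(2) moves_finite_carrier[OF h(1)]] by blast
  define p where "p k = (\<Sum>i=1..k * l. f i) * card (word_ball \<Gamma> S l)" for k
  have p: "subexp p"
    using subexp_mult[OF subexp_affine_index[OF subexp_sum[OF f], of l 0] subexp_const[of "card (word_ball \<Gamma> S l)"]]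
    by (simp add: p_def[abs_def] mult.commute)
  obtain R where R: "\<And>m. 4 * (\<Sum>k=1..m. p k * 2 ^ (m - k)) \<le> 2 ^ (R + m)"
    using subexp_head_start[OF p] by blast
  obtain K where K: "\<And>n x. x \<in> word_ball \<Gamma> S n \<Longrightarrow> tour_cost_le x (1 + K * n)"
    using tour_cost_word_ball[OF S(1) SG(1)] by blast
  \<comment> \<open>The constants are read off from the total length of the three parts for radius \<open>n\<close> and cost \<open>1 + K n\<close>.\<close>
  define A where "A = 2 + 3 * (2 + K) + 3 * K + 4 * len h * (2 + K)"
  define B where "B = 12 + 12 * len h"
  define q where "q n = p (A * n + B)" for n
  have q: "subexp q" unfolding q_def[abs_def] by (rule subexp_affine_index[OF p])
  have "subexp (\<lambda>n. 4 * (q n * ((6 * (2 + K)) * n + 22)))"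
    using subexp_mult[OF subexp_const subexp_mult[OF q subexp_affine_index[OF subexp_linear]]] .
  then obtain n0 where n0: "\<And>n. n \<ge> n0 \<Longrightarrow> 4 * (q n * ((6 * (2 + K)) * n + 22)) < 2 ^ n"
    using subexp_eventually_less by blast
  define d where "d = card S + 1"
  define U where "U n = q n * (16 * q n + 1) ^ (d * l)" for n
  have U: "subexp U"
    unfolding U_def[abs_def]
    by (intro subexp_mult[OF q] subexp_power subexp_add subexp_mult[OF subexp_const q] subexp_const)
  define F0 where "F0 = word_ball \<Gamma> S (R * l)"
  have "card (unburnt \<Gamma> S F0 W \<inter> cayley_ball \<Gamma> S n) \<le> U n"
    if W: "allowed_strategy \<Gamma> S f F0 W" and n: "n \<ge> max n0 R" for W n
  proof -
    have Wi: "W i \<subseteq> carrier \<Gamma>" "finite (W i)" "card (W i) \<le> f i" if "i \<ge> 1" for i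
      using W that by (auto simp: allowed_strategy_def)
    have Wc: "protected_by W k \<subseteq> carrier \<Gamma>" for k using Wi(1) by fastforce
    have Wfin: "finite (protected_by W k)" for k using Wi(2) by auto
    have Wcard: "card (protected_by W k) \<le> (\<Sum>i=1..k. f i)" for k
    proof -
      have "card (protected_by W k) \<le> (\<Sum>i=1..k. card (W i))" by (rule card_UN_le) simp
      also have "\<dots> \<le> (\<Sum>i=1..k. f i)" using Wi(3) by (intro sum_mono) auto
      finally show ?thesis .
    qed
    define P where "P k = protected_by W (k * l) <#>\<^bsub>\<Gamma>\<^esub> word_ball \<Gamma> S l" for k
    have P: "finite (P k)" "card (P k) \<le> p k" for k
    proof -
      have *: "finite (P k) \<and> card (P k) \<le> card (protected_by W (k * l)) * card (word_ball \<Gamma> S l)"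
        unfolding P_def by (rule card_set_mult_le[OF Wfin ball(1)])
      thus "finite (P k)" by blast
      have "card (P k) \<le> card (protected_by W (k * l)) * card (word_ball \<Gamma> S l)" using * by blast
      also have "\<dots> \<le> p k" unfolding p_def using Wcard by (rule mult_right_mono) simp
      finally show "card (P k) \<le> p k" .
    qed
    let ?N = "A * n + B"
    obtain j0 where j0: "8 * q n \<le> 2 ^ j0" "2 ^ j0 \<le> 16 * q n + 1"
      using power_of_two_between[of "8 * q n"] by auto
    obtain \<sigma> where \<sigma>: "simple_walk \<sigma> n" using exists_simple_walk[OF inf] by blast
    let ?near = "P ?N <#>\<^bsub>\<Gamma>\<^esub> word_ball \<Gamma> S (j0 * l)"
    have "unburnt \<Gamma> S F0 W \<inter> cayley_ball \<Gamma> S n \<subseteq> ?near"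
    proof
      fix x assume x: "x \<in> unburnt \<Gamma> S F0 W \<inter> cayley_ball \<Gamma> S n"
      hence xb: "x \<in> word_ball \<Gamma> S n" using W.cayley_ball_eq_word_ball[OF SG(1)] by auto
      show "x \<in> ?near"
      proof (rule ccontr)
        assume far: "x \<notin> ?near"
        have "\<exists>k. x \<in> fire \<Gamma> S F0 W k"
        proof (rule far_points_burn[OF SG h l Wc P_def P F0_def \<sigma> _ _ _ K[OF xb] refl _ _ _ far])
          show "R \<le> n" using n by simp
          show "4 * (\<Sum>i=1..n - R. p i * 2 ^ (n - R - i)) \<le> 2 ^ n" using R[of "n - R"] n by simp
          show "x \<in> carrier \<Gamma>" using xb W.word_ball_carrier[OF SG(1)] by blast
          show "n - R + (3 * (2 * Suc n + (1 + K * n)) + 3 * (1 + K * n) + 4 * len h * (2 * Suc n + (1 + K * n))) + n \<le> ?N"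
            unfolding A_def B_def by (simp add: algebra_simps)
          have "6 * (2 * Suc n + (1 + K * n)) + 4 = (6 * (2 + K)) * n + 22" by (simp add: algebra_simps)
          thus "4 * (p ?N * (6 * (2 * Suc n + (1 + K * n)) + 4)) < 2 ^ n"
            using n0[of n] n by (simp only: q_def max.bounded_iff)
          show "8 * p ?N \<le> 2 ^ j0" using j0(1) by (simp only: q_def)
        qed
        thus False using x by (auto simp: unburnt_def)
      qed
    qed
    moreover have near: "finite ?near" "card ?near \<le> card (P ?N) * card (word_ball \<Gamma> S (j0 * l))"
      using card_set_mult_le[OF P(1) ball(1)] by auto
    ultimately have "card (unburnt \<Gamma> S F0 W \<inter> cayley_ball \<Gamma> S n) \<le> card (P ?N) * card (word_ball \<Gamma> S (j0 * l))"
      using card_mono le_trans by blast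
    also have "\<dots> \<le> U n"
      unfolding U_def
    proof (rule mult_mono)
      show "card (P ?N) \<le> q n" using P(2)[of ?N] by (simp add: q_def)
      have "card (word_ball \<Gamma> S (j0 * l)) \<le> d ^ (j0 * l)" using ball(2) by (simp add: d_def)
      also have "\<dots> \<le> (2 ^ d) ^ (j0 * l)" by (intro power_mono) (auto simp: less_imp_le)
      also have "\<dots> = (2 ^ j0) ^ (d * l)" by (simp add: ac_simps flip: power_mult)
      also have "\<dots> \<le> (16 * q n + 1) ^ (d * l)" using j0(2) by (intro power_mono) auto
      finally show "card (word_ball \<Gamma> S (j0 * l)) \<le> (16 * q n + 1) ^ (d * l)" .
    qed auto
    finally show ?thesis .
  qed
  moreover have "finite F0" "F0 \<subseteq> carrier \<Gamma>"
    using ball(1) W.word_ball_carrier[OF SG(1)] by (auto simp: F0_def)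
  ultimately show ?thesis using U by blast
qed

text \<open>
  Evaluated at the radii \<open>m * l\<close>, retainment would bound \<open>2\<^sup>m\<close> by a multiple of the size of the unburnt part
  of a ball of radius \<open>O(m)\<close>.
\<close>

lemma no_subexponential_retainment:
  assumes inf: "infinite (carrier G)" and h: "h \<in> carrier H" "h \<noteq> \<one>\<^bsub>H\<^esub>"
    and S: "finite S" "symmetric_generating_set \<Gamma> S" and f: "subexp f"
  shows "\<not> retainment \<Gamma> S f"
proof
  assume ret: "retainment \<Gamma> S f"
  obtain F0 U n1 where F0: "finite F0" "F0 \<subseteq> carrier \<Gamma>" and U: "subexp U"
    and bound: "\<And>W n. allowed_strategy \<Gamma> S f F0 W \<Longrightarrow> n \<ge> n1 \<Longrightarrow>
      card (unburnt \<Gamma> S F0 W \<inter> cayley_ball \<Gamma> S n) \<le> U n"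
    using unburnt_subexponential[OF assms] by blast
  obtain W where W: "allowed_strategy \<Gamma> S f F0 W"
    and ge: "growth_le (\<lambda>n. card (cayley_ball \<Gamma> S n)) (\<lambda>n. card (unburnt \<Gamma> S F0 W \<inter> cayley_ball \<Gamma> S n))"
    using ret F0 by (auto simp: retainment_def growth_equiv_def)
  define u where "u n = card (unburnt \<Gamma> S F0 W \<inter> cayley_ball \<Gamma> S n)" for n
  obtain C :: real where C: "C > 0"
    "\<And>n. real (card (cayley_ball \<Gamma> S n)) \<le> C * real (u (nat \<lfloor>C * real n\<rfloor>)) + C"
    using ge by (auto simp: growth_le_def u_def)
  have SG: "S \<subseteq> carrier \<Gamma>" using S(2) by (auto simp: symmetric_generating_set_def)
  have ball: "cayley_ball \<Gamma> S n = word_ball \<Gamma> S n" "finite (cayley_ball \<Gamma> S n)" for n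
    using W.cayley_ball_eq_word_ball[OF SG] word_ball_finite_card[OF S(1), of \<Gamma> n] by auto
  have u_mono: "u i \<le> u j" if "i \<le> j" for i j
    unfolding u_def using ball word_ball_mono[OF that, of \<Gamma> S] by (intro card_mono) auto
  obtain l where l: "moves \<union> writing_moves h \<subseteq> word_ball \<Gamma> S l"
    using W.finite_subset_word_ball[OF S(2) moves_finite_carrier[OF h(1)]] by blast
  define c where "c = nat \<lceil>C\<rceil>"
  define D where "D = c * l + 1"
  have c: "C \<le> real c" unfolding c_def by (rule real_nat_ceiling_ge)
  have "subexp (\<lambda>m. c * U (D * m + 0) + c)"
    by (intro subexp_add subexp_mult subexp_const subexp_affine_index U)
  then obtain m0 where m0: "\<And>m. m \<ge> m0 \<Longrightarrow> c * U (D * m + 0) + c < 2 ^ m"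
    using subexp_eventually_less by blast
  define m where "m = max m0 n1"
  have "nat \<lfloor>C * real (m * l)\<rfloor> \<le> D * m"
  proof -
    have "C * real (m * l) \<le> real c * real (m * l)" using c by (rule mult_right_mono) simp
    also have "\<dots> \<le> real (D * m)" by (simp add: D_def algebra_simps)
    finally have "\<lfloor>C * real (m * l)\<rfloor> \<le> int (D * m)" by linarith
    thus ?thesis by linarith
  qed
  hence "u (nat \<lfloor>C * real (m * l)\<rfloor>) \<le> u (D * m)" by (rule u_mono)
  also have "\<dots> \<le> U (D * m)"
    unfolding u_def by (rule bound[OF W]) (simp add: m_def D_def)
  finally have uU: "u (nat \<lfloor>C * real (m * l)\<rfloor>) \<le> U (D * m)" .
  have "2 ^ m \<le> card (word_ball \<Gamma> S (m * l))"
    by (rule card_word_ball_ge[OF SG S(1) h _ inf]) (use l in blast)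
  hence "real (2 ^ m) \<le> real (card (cayley_ball \<Gamma> S (m * l)))" unfolding ball by (rule of_nat_mono)
  also have "\<dots> \<le> C * real (u (nat \<lfloor>C * real (m * l)\<rfloor>)) + C" by (rule C(2))
  also have "\<dots> \<le> real c * real (U (D * m)) + real c"
    using c C(1) uU by (intro add_mono mult_mono) auto
  also have "\<dots> = real (c * U (D * m) + c)" by simp
  finally have "2 ^ m \<le> c * U (D * m) + c" by (rule of_nat_le_iff[THEN iffD1])
  thus False using m0[of m] by (simp add: m_def)
qed

end

theorem theorem1p8:
  fixes G :: "('a, 'c) monoid_scheme" and H :: "('b, 'd) monoid_scheme"
    and S :: "('a \<times> ('a \<Rightarrow> 'b)) set" and f :: "nat \<Rightarrow> nat"
  assumes "finitely_generated_group G" and "infinite (carrier G)"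
    and "finitely_generated_group H" and "\<exists>x\<in>carrier H. \<exists>y\<in>carrier H. x \<noteq> y"
    and "finite S" and "symmetric_generating_set (wreath_product H G) S"
    and "subexponential f"
  shows "\<not> retainment (wreath_product H G) S f"
proof -
  interpret G: group G using assms(1) by (simp add: finitely_generated_group_def)
  interpret H: group H using assms(3) by (simp add: finitely_generated_group_def)
  obtain Q where Q: "finite Q" "\<one>\<^bsub>G\<^esub> \<in> Q" "symmetric_generating_set G Q"
    using G.exists_symmetric_generating_set[OF assms(1)] by blast
  obtain Q' where Q': "finite Q'" "symmetric_generating_set H Q'"
    using H.exists_symmetric_generating_set[OF assms(3)] by blast
  interpret wreath_generators G H Q Q'
    using Q Q' by unfold_locales auto
  obtain h where "h \<in> carrier H" "h \<noteq> \<one>\<^bsub>H\<^esub>" using assms(4) by metis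
  thus ?thesis
    using no_subexponential_retainment assms(2,5,6) subexponential_imp_subexp[OF assms(7)] by blast
qed

end
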